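(* Let $n\in\mathbb{N}$. Then an orthodox semigroup is $n$-supernilpotent if and only if it is $n$-nilpotent.
   Context: $\mathbb{N}$ is the set of positive integers. A semigroup $\mathbf{S}$ is regular if for every $x\in S$ there is $y\in S$ with $xyx=x$. A regular semigroup is orthodox if its set of idempotents $E(S)=\{a\in S: a^2=a\}$ is a subsemigroup. Commutators. Let $\mathbf{A}$ be an algebra, $\operatorname{Con}(\mathbf{A})$ its congruence lattice with least element $0_A$ (equality) and greatest element $1_A=A\times A$, and $\operatorname{Pol}(\mathbf{A})$ its set of polynomial operations (operations built from the basic operations, variables and constants from $A$; for a semigroup, products of variables and constants). For tuples, $\mathbf{x}\;\alpha\;\mathbf{y}$ means coordinatewise relatedness. For $k\ge 1$ and $\alpha_1,\dots,\alpha_k,\beta,\delta\in\operatorname{Con}(\mathbf{A})$, the condition $C(\alpha_1,\dots,\alpha_k,\beta;\delta)$ means: for all $n_1,\dots,n_k,m\in\mathbb{N}$, every $p\in\operatorname{Pol}(\mathbf{A})$ of arity $n_1+\dots+n_k+m$, and all $\mathbf{a}_j,\mathbf{b}_j\in A^{n_j}$ with $\mathbf{a}_j\;\alpha_j\;\mathbf{b}_j$ ($j=1,\dots,k$) and $\mathbf{c},\mathbf{d}\in A^m$ with $\mathbf{c}\;\beta\;\mathbf{d}$: if $p(\mathbf{x}_1,\dots,\mathbf{x}_k,\mathbf{c})\;\delta\;p(\mathbf{x}_1,\dots,\mathbf{x}_k,\mathbf{d})$ for all choices $\mathbf{x}_j\in\{\mathbf{a}_j,\mathbf{b}_j\}$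 other than the choice $(\mathbf{x}_1,\dots,\mathbf{x}_k)=(\mathbf{b}_1,\dots,\mathbf{b}_k)$, then $p(\mathbf{b}_1,\dots,\mathbf{b}_k,\mathbf{c})\;\delta\;p(\mathbf{b}_1,\dots,\mathbf{b}_k,\mathbf{d})$. For $k\ge 2$, the $k$-ary commutator $[\alpha_1,\dots,\alpha_k]$ is the smallest congruence $\delta$ with $C(\alpha_1,\dots,\alpha_k;\delta)$ (with $\alpha_k$ in the role of $\beta$). An algebra $\mathbf{A}$ is $n$-supernilpotent if $[\,\underbrace{1_A,\dots,1_A}_{n+1}\,]=0_A$. Put $(1_A,1_A]^{(1)}=[1_A,1_A]$ and $(1_A,1_A]^{(k+1)}=[1_A,(1_A,1_A]^{(k)}]$; $\mathbf{A}$ is $n$-nilpotent if $(1_A,1_A]^{(n)}=0_A$. *)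

theory Defs
  imports Main
begin

locale regular_semigroup = semigroup +
  assumes regular: "\<exists>y. x \<^bold>* y \<^bold>* x = x"

locale orthodox_semigroup = regular_semigroup +
  assumes idempotents_closed:
    "a \<^bold>* a = a \<Longrightarrow> b \<^bold>* b = b \<Longrightarrow> (a \<^bold>* b) \<^bold>* (a \<^bold>* b) = a \<^bold>* b"

text \<open>
  Below, an algebra is a type \<open>'a\<close> with one binary operation \<open>f\<close>.
  Its congruences are relations of type \<open>'a rel\<close>, so its least and greatest congruences are
  \<^const>\<open>Id\<close> and \<^const>\<open>UNIV\<close>.
\<close>

definition congruence :: "('a \<Rightarrow> 'a \<Rightarrow> 'a) \<Rightarrow> 'a rel \<Rightarrow> bool" where
  "congruence f r \<longleftrightarrow> equiv UNIV r \<and>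
     (\<forall>x y u v. (x, y) \<in> r \<longrightarrow> (u, v) \<in> r \<longrightarrow> (f x u, f y v) \<in> r)"

text \<open>
  Polynomial operations of arity \<open>N\<close>. A tuple is a list of length \<open>N\<close>; the values on lists of
  other lengths are never used.
\<close>

inductive_set Pol :: "('a \<Rightarrow> 'a \<Rightarrow> 'a) \<Rightarrow> nat \<Rightarrow> ('a list \<Rightarrow> 'a) set"
  for f :: "'a \<Rightarrow> 'a \<Rightarrow> 'a" and N :: nat where
  Pol_var: "i < N \<Longrightarrow> (\<lambda>x. x ! i) \<in> Pol f N"
| Pol_const: "(\<lambda>x. a) \<in> Pol f N"
| Pol_mult: "p \<in> Pol f N \<Longrightarrow> q \<in> Pol f N \<Longrightarrow> (\<lambda>x. f (p x) (q x)) \<in> Pol f N"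

text \<open>
  The list of blocks in which the \<open>j\<close>-th block is \<open>b ! j\<close> for \<open>j \<in> J\<close> and \<open>a ! j\<close> otherwise.
\<close>

definition choice :: "nat set \<Rightarrow> 'b list \<Rightarrow> 'b list \<Rightarrow> 'b list" where
  "choice J a b = map (\<lambda>j. if j \<in> J then b ! j else a ! j) [0..<length a]"

text \<open>
  The condition \<open>C(\<alpha>\<^sub>1, \<dots>, \<alpha>\<^sub>k, \<beta>; \<delta>)\<close>, where \<open>\<alpha>s\<close> is the list of the \<open>\<alpha>\<^sub>j\<close>. The blocks
  \<open>a ! j\<close>, \<open>b ! j\<close> and the tuples \<open>c\<close>, \<open>d\<close> have arbitrary positive lengths.

  The choices of the blocks are indexed by \<open>J \<subseteq> {..<k}\<close>, and only the index set \<open>J = {..<k}\<close>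
  is excluded from the premise. Excluding instead every choice whose value is \<open>b\<close> would be too
  strong if \<open>a ! j = b ! j\<close> for some \<open>j\<close>: for \<open>k = 1\<close> and \<open>a = b\<close> the premise would be empty, and
  the condition would force \<open>\<beta> \<subseteq> \<delta>\<close>.
\<close>

definition centralizes :: "('a \<Rightarrow> 'a \<Rightarrow> 'a) \<Rightarrow> 'a rel list \<Rightarrow> 'a rel \<Rightarrow> 'a rel \<Rightarrow> bool" where
  "centralizes f \<alpha>s \<beta> \<delta> \<longleftrightarrow>
     (\<forall>a b c d p.
        length a = length \<alpha>s \<longrightarrow> length b = length \<alpha>s \<longrightarrow>
        (\<forall>j < length \<alpha>s. a ! j \<noteq> [] \<and> list_all2 (\<lambda>x y. (x, y) \<in> \<alpha>s ! j) (a ! j) (b ! j)) \<longrightarrow>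
        c \<noteq> [] \<longrightarrow> list_all2 (\<lambda>x y. (x, y) \<in> \<beta>) c d \<longrightarrow>
        p \<in> Pol f (length (concat a) + length c) \<longrightarrow>
        (\<forall>J. J \<subset> {..<length \<alpha>s} \<longrightarrow>
           (p (concat (choice J a b) @ c), p (concat (choice J a b) @ d)) \<in> \<delta>) \<longrightarrow>
        (p (concat b @ c), p (concat b @ d)) \<in> \<delta>)"

text \<open>
  The commutator \<open>[\<alpha>\<^sub>1, \<dots>, \<alpha>\<^sub>k]\<close> of a list of \<open>k \<ge> 2\<close> congruences; \<open>LEAST\<close> is with respect to
  inclusion.
\<close>

definition commutator :: "('a \<Rightarrow> 'a \<Rightarrow> 'a) \<Rightarrow> 'a rel list \<Rightarrow> 'a rel" where
  "commutator f \<alpha>s = (LEAST \<delta>. congruence f \<delta> \<and> centralizes f (butlast \<alpha>s) (last \<alpha>s) \<delta>)"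

lemma congruence_Inter:
  assumes "\<And>\<delta>. \<delta> \<in> D \<Longrightarrow> congruence f \<delta>"
  shows "congruence f (\<Inter>D)"
proof -
  have "equiv UNIV (\<Inter>D)"
  proof (rule equivI)
    show "refl_on UNIV (\<Inter>D)"
      using assms by (auto simp: congruence_def equiv_def refl_on_def)
    show "sym (\<Inter>D)"
    proof (rule symI, rule InterI)
      fix x y \<delta>
      assume "(x, y) \<in> \<Inter>D" and \<delta>: "\<delta> \<in> D"
      moreover have "sym \<delta>"
        using assms[OF \<delta>] by (simp add: congruence_def equiv_def)
      ultimately show "(y, x) \<in> \<delta>"
        by (meson InterD symD)
    qed
    show "trans (\<Inter>D)"
    proof (rule transI, rule InterI)
      fix x y z \<delta>
      assume "(x, y) \<in> \<Inter>D" "(y, z) \<in> \<Inter>D" and \<delta>: "\<delta> \<in> D"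
      moreover have "trans \<delta>"
        using assms[OF \<delta>] by (simp add: congruence_def equiv_def)
      ultimately show "(x, z) \<in> \<delta>"
        by (meson InterD transD)
    qed
  qed simp
  moreover have "(f x u, f y v) \<in> \<Inter>D" if "(x, y) \<in> \<Inter>D" "(u, v) \<in> \<Inter>D" for x y u v
    using assms that by (simp add: congruence_def)
  ultimately show ?thesis
    by (simp add: congruence_def)
qed

lemma centralizes_Inter:
  assumes "\<And>\<delta>. \<delta> \<in> D \<Longrightarrow> centralizes f \<alpha>s \<beta> \<delta>"
  shows "centralizes f \<alpha>s \<beta> (\<Inter>D)"
  unfolding centralizes_def
proof (intro allI impI InterI)
  fix a b c d p \<delta>
  assume "length a = length \<alpha>s" "length b = length \<alpha>s"
    "\<forall>j < length \<alpha>s. a ! j \<noteq> [] \<and> list_all2 (\<lambda>x y. (x, y) \<in> \<alpha>s ! j) (a ! j) (b ! j)"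
    "c \<noteq> []" "list_all2 (\<lambda>x y. (x, y) \<in> \<beta>) c d"
    "p \<in> Pol f (length (concat a) + length c)"
    "\<forall>J. J \<subset> {..<length \<alpha>s} \<longrightarrow>
       (p (concat (choice J a b) @ c), p (concat (choice J a b) @ d)) \<in> \<Inter>D"
    and \<delta>: "\<delta> \<in> D"
  then show "(p (concat b @ c), p (concat b @ d)) \<in> \<delta>"
    using assms[OF \<delta>, unfolded centralizes_def, rule_format, of a b c d p] by auto
qed

text \<open>The least congruence in the definition of the commutator exists.\<close>

lemma commutator_least:
  shows commutator_congruence: "congruence f (commutator f \<alpha>s)"
    and commutator_centralizes: "centralizes f (butlast \<alpha>s) (last \<alpha>s) (commutator f \<alpha>s)"
    and commutator_minimal: "congruence f \<delta> \<Longrightarrow> centralizes f (butlast \<alpha>s) (last \<alpha>s) \<delta> \<Longrightarrow>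
      commutator f \<alpha>s \<subseteq> \<delta>"
proof -
  let ?P = "\<lambda>\<delta>. congruence f \<delta> \<and> centralizes f (butlast \<alpha>s) (last \<alpha>s) \<delta>"
  have P: "?P (\<Inter>{\<delta>. ?P \<delta>})"
    by (intro conjI congruence_Inter centralizes_Inter) auto
  have eq: "commutator f \<alpha>s = \<Inter>{\<delta>. ?P \<delta>}"
    unfolding commutator_def by (rule Least_equality[where P = ?P, OF P]) (rule Inter_lower, simp)
  show "congruence f (commutator f \<alpha>s)"
    and "centralizes f (butlast \<alpha>s) (last \<alpha>s) (commutator f \<alpha>s)"
    using P eq by simp_all
  show "commutator f \<alpha>s \<subseteq> \<delta>" if "congruence f \<delta>" "centralizes f (butlast \<alpha>s) (last \<alpha>s) \<delta>"
    unfolding eq by (rule Inter_lower) (simp add: that)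
qed

definition supernilpotent :: "('a \<Rightarrow> 'a \<Rightarrow> 'a) \<Rightarrow> nat \<Rightarrow> bool" where
  "supernilpotent f n \<longleftrightarrow> commutator f (replicate (n + 1) UNIV) = Id"

text \<open>
  The series \<open>(1\<^sub>A, 1\<^sub>A]\<^sup>(\<^sup>k\<^sup>)\<close>, extended by \<open>1\<^sub>A\<close> at \<open>k = 0\<close>, so that its value at \<open>1\<close> is
  \<open>[1\<^sub>A, 1\<^sub>A]\<close>.
\<close>

primrec central_series :: "('a \<Rightarrow> 'a \<Rightarrow> 'a) \<Rightarrow> nat \<Rightarrow> 'a rel" where
  "central_series f 0 = UNIV"
| "central_series f (Suc k) = commutator f [UNIV, central_series f k]"

definition nilpotent :: "('a \<Rightarrow> 'a \<Rightarrow> 'a) \<Rightarrow> nat \<Rightarrow> bool" where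
  "nilpotent f n \<longleftrightarrow> central_series f n = Id"

end

theory Submission
  imports Defs "HOL-Algebra.Coset"
begin

text \<open>
  Both conditions force the semigroup to be a rectangular group, that is, a direct product of a
  left zero semigroup, a group and a right zero semigroup, and for rectangular groups both say that
  the group factor has nilpotency class at most \<open>n\<close>.

  If \<open>k \<le> g\<close> are idempotents, then the products \<open>x\<^sub>0 x\<^sub>1 \<dots> x\<^sub>n\<close> with factors in \<open>{g, k}\<close> equal \<open>k\<close>
  unless all factors are \<open>g\<close>. The term condition for such products, used once for
  supernilpotency and once at each step of the central series for nilpotency, gives \<open>k = g\<close>
  (\<open>supernilpotent_below_idempotent\<close>, \<open>nilpotent_below_idempotent\<close>). In an orthodox semigroup
  \<open>g h g \<le> g\<close> for idempotents \<open>g\<close> and \<open>h\<close>, so \<open>g h g = g\<close>, and then \<open>x u y = x y\<close> whenever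
  \<open>u\<close> is idempotent (\<open>rectangular_groupI\<close>). For a fixed idempotent \<open>e\<close>, the map \<open>x \<mapsto> e x e\<close> is
  therefore a homomorphism onto the group \<open>G = e S e\<close>. Its kernel meets the Green relations \<open>R\<close> and
  \<open>L\<close> in the identity (\<open>left_right_core_eq\<close>). Modulo \<open>R\<close> or \<open>L\<close> every polynomial is constant or a
  single variable, so these two congruences satisfy every term condition
  (\<open>centralizes_projection\<close>), and only \<open>G\<close> matters.

  Let \<open>Z\<^sub>i\<close> be the upper central series of \<open>G\<close>. Inverses in \<open>G\<close> are not polynomials, but the blocks
  of the term condition may be pairs \<open>(h, h\<^sup>-\<^sup>1)\<close>, which makes commutators available, and
  both hypotheses give \<open>Z\<^sub>n = G\<close>. Conversely, let \<open>Z\<^sub>n = G\<close>. Nilpotency follows because changing the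
  arguments of a polynomial within a class modulo \<open>Z\<^sub>i\<^sub>+\<^sub>1\<close> multiplies its value by an element
  that, modulo \<open>Z\<^sub>i\<close>, is central and independent of the other arguments
  (\<open>Pol_central_shift\<close>). Supernilpotency is the assertion that a
  cube \<open>{0, 1}\<^sup>n\<^sup>+\<^sup>1 \<rightarrow> G\<close> that is a product of functions of one coordinate each, and
  whose two values along the last direction agree over every vertex but the top one, also has
  equal values there. Each difference of such a cube in a coordinate direction lies one step
  deeper in a central series, and after \<open>n + 1\<close> differences only \<open>1\<close> is left
  (\<open>face_words_term_condition\<close>).
\<close>

section \<open>Words, commutators and the upper central series of a group\<close>

context group
begin

text \<open>
  Added to associativity, \<open>inv_mult_group\<close> and the cancellation rules for units and inverses, these
  equations complete a convergent rewriting system, so that the simplifier decides identities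
  between group words.
\<close>

lemma inv_cancel_left:
  assumes "x \<in> carrier G" "y \<in> carrier G"
  shows "x \<otimes> (inv x \<otimes> y) = y" and "inv x \<otimes> (x \<otimes> y) = y"
  using assms by (simp_all flip: m_assoc)

lemmas word_simps = m_assoc inv_mult_group inv_cancel_left

definition comm :: "'a \<Rightarrow> 'a \<Rightarrow> 'a" where
  "comm x y = inv x \<otimes> inv y \<otimes> x \<otimes> y"

lemma comm_closed [simp]: "x \<in> carrier G \<Longrightarrow> y \<in> carrier G \<Longrightarrow> comm x y \<in> carrier G"
  by (simp add: comm_def)

lemma comm_one [simp]: "x \<in> carrier G \<Longrightarrow> comm x \<one> = \<one>" "x \<in> carrier G \<Longrightarrow> comm \<one> x = \<one>"
  by (simp_all add: comm_def)

primrec upper_central :: "nat \<Rightarrow> 'a set" where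
  "upper_central 0 = {\<one>}"
| "upper_central (Suc i) = {g \<in> carrier G. \<forall>h \<in> carrier G. comm g h \<in> upper_central i}"

lemma upper_central_normal: "upper_central i \<lhd> G"
proof (induction i)
  case 0
  show ?case
    by (simp add: one_is_normal)
next
  case (Suc i)
  then interpret Z: normal "upper_central i" G .
  have conj: "inv u \<otimes> z \<otimes> u \<in> upper_central i" if "u \<in> carrier G" "z \<in> upper_central i" for u z
    using Z.inv_op_closed1[OF that] .
  show ?case
  proof (rule normal_invI)
    show "subgroup (upper_central (Suc i)) G"
    proof (rule subgroupI)
      fix x
      assume x: "x \<in> upper_central (Suc i)"
      have "comm (inv x) h \<in> upper_central i" if h: "h \<in> carrier G" for h
      proof -
        have "comm (inv x) h = inv (inv x) \<otimes> inv (comm x h) \<otimes> inv x"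
          using x h by (simp add: comm_def word_simps)
        then show ?thesis
          using x h conj[of "inv x" "inv (comm x h)"] by simp
      qed
      then show "inv x \<in> upper_central (Suc i)"
        using x by simp
    next
      fix x y
      assume x: "x \<in> upper_central (Suc i)" and y: "y \<in> upper_central (Suc i)"
      have "comm (x \<otimes> y) h \<in> upper_central i" if h: "h \<in> carrier G" for h
      proof -
        have "comm (x \<otimes> y) h = (inv y \<otimes> comm x h \<otimes> y) \<otimes> comm y h"
          using x y h by (simp add: comm_def word_simps)
        then show ?thesis
          using x y h conj[of y "comm x h"] by simp
      qed
      then show "x \<otimes> y \<in> upper_central (Suc i)"
        using x y by simp
    qed (auto intro: exI[of _ \<one>])
  next
    fix x u
    assume x: "x \<in> upper_central (Suc i)" and u: "u \<in> carrier G"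
    have "comm (u \<otimes> x \<otimes> inv u) h \<in> upper_central i" if h: "h \<in> carrier G" for h
    proof -
      have "comm (u \<otimes> x \<otimes> inv u) h = inv (inv u) \<otimes> comm x (inv u \<otimes> h \<otimes> u) \<otimes> inv u"
        using x u h by (simp add: comm_def word_simps)
      then show ?thesis
        using x u h conj[of "inv u" "comm x (inv u \<otimes> h \<otimes> u)"] by simp
    qed
    then show "u \<otimes> x \<otimes> inv u \<in> upper_central (Suc i)"
      using x u by simp
  qed
qed

lemma upper_central_subset: "upper_central i \<subseteq> carrier G"
  using upper_central_normal[of i] by (simp add: normal_def subgroup.subset)

lemma upper_central_mult:
  "x \<in> upper_central i \<Longrightarrow> y \<in> upper_central i \<Longrightarrow> x \<otimes> y \<in> upper_central i"
  using upper_central_normal[of i] by (simp add: normal_def subgroup.m_closed)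

lemma upper_central_one: "\<one> \<in> upper_central i"
  using upper_central_normal[of i] by (simp add: normal_def subgroup.one_closed)

lemma upper_central_inv: "x \<in> upper_central i \<Longrightarrow> inv x \<in> upper_central i"
  using upper_central_normal[of i] by (simp add: normal_def subgroup.m_inv_closed)

lemma upper_central_conj:
  "u \<in> carrier G \<Longrightarrow> x \<in> upper_central i \<Longrightarrow> inv u \<otimes> x \<otimes> u \<in> upper_central i"
  by (rule normal.inv_op_closed1[OF upper_central_normal])

primrec iterated_comm :: "(nat \<Rightarrow> 'a) \<Rightarrow> nat \<Rightarrow> 'a" where
  "iterated_comm h 0 = h 0"
| "iterated_comm h (Suc j) = comm (iterated_comm h j) (h (Suc j))"

lemma iterated_comm_closed: "range h \<subseteq> carrier G \<Longrightarrow> iterated_comm h j \<in> carrier G"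
  by (induction j) (simp_all add: range_subsetD)

lemma iterated_comm_cong: "(\<And>i. i \<le> j \<Longrightarrow> h i = h' i) \<Longrightarrow> iterated_comm h j = iterated_comm h' j"
  by (induction j) simp_all

lemma iterated_comm_trivial:
  assumes "range h \<subseteq> carrier G" "i \<le> j" "h i = \<one>"
  shows "iterated_comm h j = \<one>"
  using assms(2)
proof (induction j)
  case 0
  then show ?case
    using assms(3) by simp
next
  case (Suc j)
  show ?case
  proof (cases "i = Suc j")
    case True
    then show ?thesis
      using assms iterated_comm_closed[of h j] by simp
  next
    case False
    then have "iterated_comm h j = \<one>"
      using Suc by simp
    then show ?thesis
      using assms(1) by (simp add: range_subsetD)
  qed
qed

text \<open>
  The entries up to \<open>h k\<close> are those already absorbed into the commutator; the induction on \<open>n\<close>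
  lets \<open>k\<close> grow, because membership in \<open>upper_central (Suc n)\<close> appends one entry.
\<close>

lemma iterated_comm_upper_central:
  assumes "\<And>h. range h \<subseteq> carrier G \<Longrightarrow> iterated_comm h (k + n) = \<one>" "range h \<subseteq> carrier G"
  shows "iterated_comm h k \<in> upper_central n"
  using assms
proof (induction n arbitrary: k h)
  case 0
  then show ?case
    by simp
next
  case (Suc n)
  have "comm (iterated_comm h k) u \<in> upper_central n" if u: "u \<in> carrier G" for u
  proof -
    have "iterated_comm (h(Suc k := u)) (Suc k) \<in> upper_central n"
      using Suc.prems u by (intro Suc.IH) auto
    moreover have "iterated_comm (h(Suc k := u)) k = iterated_comm h k"
      by (rule iterated_comm_cong) simp
    ultimately show ?thesis
      by simp
  qed
  then show ?case
    using iterated_comm_closed[OF Suc.prems(2)] by simp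
qed

section \<open>Cubes in a group\<close>

text \<open>
  A vertex of the \<open>m\<close>-dimensional cube is a set \<open>J \<subseteq> {..<m}\<close> of coordinates. A face word is a product
  of functions of one coordinate each. These are the values of a polynomial at the choices of
  blocks in a term condition.
\<close>

inductive_set face_words :: "nat \<Rightarrow> (nat set \<Rightarrow> 'a) set" for m where
  face: "j < m \<Longrightarrow> g \<in> carrier G \<Longrightarrow> h \<in> carrier G \<Longrightarrow> (\<lambda>J. if j \<in> J then g else h) \<in> face_words m"
| const: "g \<in> carrier G \<Longrightarrow> (\<lambda>J. g) \<in> face_words m"
| mult: "x \<in> face_words m \<Longrightarrow> y \<in> face_words m \<Longrightarrow> (\<lambda>J. x J \<otimes> y J) \<in> face_words m"

text \<open>
  Let \<open>N\<close> be the normal closure of the constants in the group of face words. The predicate describes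
  the lower central series of \<open>N\<close>, indexed from \<open>0\<close> for \<open>N\<close> itself. Commutators with constants
  suffice as generators, because \<open>[x, g\<^sup>u] = [u x u\<^sup>-\<^sup>1, g]\<^sup>u\<close> where \<open>y\<^sup>u = u\<^sup>-\<^sup>1 y u\<close>. Restricting to
  them makes the difference of \<open>[x, g]\<close> in a coordinate direction easy to control, since \<open>g\<close> does
  not change.
\<close>

inductive const_lower_central :: "nat \<Rightarrow> nat \<Rightarrow> (nat set \<Rightarrow> 'a) \<Rightarrow> bool" for m where
  const: "g \<in> carrier G \<Longrightarrow> const_lower_central m 0 (\<lambda>J. g)"
| one: "const_lower_central m k (\<lambda>J. \<one>)"
| mult: "const_lower_central m k x \<Longrightarrow> const_lower_central m k y \<Longrightarrow>
    const_lower_central m k (\<lambda>J. x J \<otimes> y J)"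
| conj: "const_lower_central m k x \<Longrightarrow> u \<in> face_words m \<Longrightarrow>
    const_lower_central m k (\<lambda>J. inv (u J) \<otimes> x J \<otimes> u J)"
| comm: "const_lower_central m k x \<Longrightarrow> g \<in> carrier G \<Longrightarrow>
    const_lower_central m (Suc k) (\<lambda>J. comm (x J) g)"

lemma face_words_closed [simp]: "x \<in> face_words m \<Longrightarrow> x J \<in> carrier G"
  by (induction rule: face_words.induct) auto

lemma face_words_inv: "x \<in> face_words m \<Longrightarrow> (\<lambda>J. inv (x J)) \<in> face_words m"
proof (induction rule: face_words.induct)
  case (face j g h)
  then have "(\<lambda>J. if j \<in> J then inv g else inv h) \<in> face_words m"
    by (intro face_words.face) auto
  then show ?case
    by (simp add: if_distrib)
next
  case (mult x y)
  have "(\<lambda>J. inv (y J) \<otimes> inv (x J)) \<in> face_words m"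
    by (intro face_words.mult mult)
  then show ?case
    using mult.hyps by (simp add: inv_mult_group)
qed (auto intro: face_words.const)

lemma const_lower_central_face_words: "const_lower_central m k x \<Longrightarrow> x \<in> face_words m"
proof (induction rule: const_lower_central.induct)
  case (comm k x g)
  show ?case
    unfolding comm_def by (intro face_words.mult face_words_inv comm face_words.const)
qed (auto intro!: face_words.mult face_words_inv intro: face_words.const)

lemma const_lower_central_closed [simp]: "const_lower_central m k x \<Longrightarrow> x J \<in> carrier G"
  by (rule face_words_closed[OF const_lower_central_face_words])

lemma const_lower_central_inv: "const_lower_central m k x \<Longrightarrow> const_lower_central m k (\<lambda>J. inv (x J))"
proof (induction rule: const_lower_central.induct)
  case (mult k x y)
  have "const_lower_central m k (\<lambda>J. inv (y J) \<otimes> inv (x J))"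
    by (intro const_lower_central.mult mult)
  then show ?case
    using mult.hyps by (simp add: inv_mult_group)
next
  case (conj k x u)
  have "const_lower_central m k (\<lambda>J. inv (u J) \<otimes> inv (x J) \<otimes> u J)"
    by (intro const_lower_central.conj conj)
  then show ?case
    using conj.hyps by (simp add: word_simps)
next
  case (comm k x g)
  have "const_lower_central m (Suc k) (\<lambda>J. inv (x J) \<otimes> comm (inv (x J)) g \<otimes> x J)"
    using comm by (intro const_lower_central.conj const_lower_central.comm const_lower_central_face_words)
  then show ?case
    using comm.hyps by (simp add: comm_def word_simps)
qed (auto intro: const_lower_central.const const_lower_central.one)

lemma const_lower_central_subset: "const_lower_central m k x \<Longrightarrow> const_lower_central m 0 x"
proof (induction rule: const_lower_central.induct)
  case (comm k x g)
  have "const_lower_central m 0 (\<lambda>J. inv (x J) \<otimes> (inv g \<otimes> x J \<otimes> g))"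
    using comm
    by (intro const_lower_central.mult const_lower_central_inv
        const_lower_central.conj[where u = "\<lambda>J. g"] face_words.const)
  then show ?case
    using comm.hyps by (simp add: comm_def word_simps)
qed (auto intro: const_lower_central.intros)

text \<open>
  Commutators with arbitrary elements of the normal closure, by
  \<open>[x, y z] = [x, z] [x, y]\<^sup>z\<close> and \<open>[x, y\<^sup>u] = [u x u\<^sup>-\<^sup>1, y]\<^sup>u\<close>.
\<close>

lemma const_lower_central_comm:
  assumes "const_lower_central m 0 y" "const_lower_central m k x"
  shows "const_lower_central m (Suc k) (\<lambda>J. comm (x J) (y J))"
  using assms
proof (induction "0 :: nat" y arbitrary: x rule: const_lower_central.induct)
  case (const g)
  then show ?case
    by (simp add: const_lower_central.comm)
next
  case one
  then show ?case
    by (simp add: const_lower_central.one)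
next
  case (mult y z)
  have "const_lower_central m (Suc k)
      (\<lambda>J. comm (x J) (z J) \<otimes> (inv (z J) \<otimes> comm (x J) (y J) \<otimes> z J))"
    using mult by (intro const_lower_central.mult const_lower_central.conj)
        (auto intro: const_lower_central_face_words)
  then show ?case
    using mult by (simp add: comm_def word_simps)
next
  case (conj y u)
  have "const_lower_central m k (\<lambda>J. inv (inv (u J)) \<otimes> x J \<otimes> inv (u J))"
    using conj by (intro const_lower_central.conj face_words_inv)
  then have "const_lower_central m (Suc k) (\<lambda>J. comm (inv (inv (u J)) \<otimes> x J \<otimes> inv (u J)) (y J))"
    using conj by blast
  then have "const_lower_central m (Suc k)
      (\<lambda>J. inv (u J) \<otimes> comm (inv (inv (u J)) \<otimes> x J \<otimes> inv (u J)) (y J) \<otimes> u J)"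
    using conj by (intro const_lower_central.conj)
  then show ?case
    using conj by (simp add: comm_def word_simps)
qed

text \<open>
  A face word of dimension \<open>Suc m\<close> is the pair of its restrictions to the two opposite faces in the
  direction \<open>m\<close>. On these faces a function of the coordinate \<open>m\<close> becomes a constant, and all other
  generators agree, so the quotient of the restrictions is a product of conjugates of constants.
\<close>

lemma face_words_split:
  assumes "x \<in> face_words (Suc m)"
  shows "(\<lambda>J. x (J - {m})) \<in> face_words m \<and> (\<lambda>J. x (insert m J)) \<in> face_words m
    \<and> const_lower_central m 0 (\<lambda>J. inv (x (J - {m})) \<otimes> x (insert m J))"
  using assms
proof (induction rule: face_words.induct)
  case (face j g h)
  show ?case
  proof (cases "j = m")
    case True
    then show ?thesis
      using face by (auto intro: face_words.const const_lower_central.const)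
  next
    case False
    have "(\<lambda>J. inv (if j \<in> J then g else h) \<otimes> (if j \<in> J then g else h)) = (\<lambda>J. \<one>)"
      using face by auto
    then show ?thesis
      using False face by (auto intro: face_words.face const_lower_central.one)
  qed
next
  case (const g)
  then show ?case
    by (auto intro: face_words.const const_lower_central.one)
next
  case (mult x y)
  let ?x = "\<lambda>J. x (J - {m})" and ?x' = "\<lambda>J. inv (x (J - {m})) \<otimes> x (insert m J)"
  let ?y = "\<lambda>J. y (J - {m})" and ?y' = "\<lambda>J. inv (y (J - {m})) \<otimes> y (insert m J)"
  have "const_lower_central m 0 (\<lambda>J. (inv (?y J) \<otimes> ?x' J \<otimes> ?y J) \<otimes> ?y' J)"
    using mult by (intro const_lower_central.mult[OF const_lower_central.conj]) auto
  then have "const_lower_central m 0 (\<lambda>J. inv (?x J \<otimes> ?y J) \<otimes> (x (insert m J) \<otimes> y (insert m J)))"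
    using mult.hyps by (simp add: word_simps)
  then show ?case
    using mult by (auto intro: face_words.mult)
qed

text \<open>
  The key step: taking the difference in a coordinate direction moves one step down the lower
  central series. Write \<open>x\<^sub>1 = x\<^sub>0 x'\<close> for the restrictions of \<open>x\<close> to the two faces. If
  \<open>x\<close> is conjugated by \<open>u\<close>, where \<open>u\<^sub>1 = u\<^sub>0 u'\<close>, then the difference is \<open>[v, u']\<close> times the conjugate of
  \<open>x'\<close> by \<open>u\<^sub>1\<close>, where \<open>v\<close> is the conjugate of \<open>x\<^sub>0\<close> by \<open>u\<^sub>0\<close> and \<open>u'\<close> lies in the normal closure of the
  constants. For the commutator with a constant \<open>g\<close> it is \<open>[[x\<^sub>0, g], x'] [x', g]\<close>, and \<open>x'\<close>, being
  deeper in the series, again lies in the normal closure.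
\<close>

lemma const_lower_central_split:
  assumes "const_lower_central (Suc m) k x"
  shows "const_lower_central m k (\<lambda>J. x (J - {m}))
    \<and> const_lower_central m (Suc k) (\<lambda>J. inv (x (J - {m})) \<otimes> x (insert m J))"
  using assms
proof (induction rule: const_lower_central.induct)
  case (const g)
  then show ?case
    by (auto intro: const_lower_central.const const_lower_central.one)
next
  case (one k)
  then show ?case
    by (auto intro: const_lower_central.one)
next
  case (mult k x y)
  let ?x = "\<lambda>J. x (J - {m})" and ?x' = "\<lambda>J. inv (x (J - {m})) \<otimes> x (insert m J)"
  let ?y = "\<lambda>J. y (J - {m})" and ?y' = "\<lambda>J. inv (y (J - {m})) \<otimes> y (insert m J)"
  have "const_lower_central m (Suc k) (\<lambda>J. (inv (?y J) \<otimes> ?x' J \<otimes> ?y J) \<otimes> ?y' J)"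
    using mult by (intro const_lower_central.mult[OF const_lower_central.conj])
      (auto intro: const_lower_central_face_words)
  then have "const_lower_central m (Suc k) (\<lambda>J. inv (?x J \<otimes> ?y J) \<otimes> (x (insert m J) \<otimes> y (insert m J)))"
    using mult.hyps by (simp add: word_simps)
  then show ?case
    using mult by (auto intro: const_lower_central.mult)
next
  case (conj k x u)
  let ?x = "\<lambda>J. x (J - {m})" and ?x' = "\<lambda>J. inv (x (J - {m})) \<otimes> x (insert m J)"
  let ?u = "\<lambda>J. u (J - {m})" and ?u' = "\<lambda>J. inv (u (J - {m})) \<otimes> u (insert m J)"
  have u: "?u \<in> face_words m" "(\<lambda>J. u (insert m J)) \<in> face_words m" "const_lower_central m 0 ?u'"
    using face_words_split[OF conj.hyps(2)] by auto
  have x0: "const_lower_central m k (\<lambda>J. inv (?u J) \<otimes> ?x J \<otimes> ?u J)"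
    using conj u by (intro const_lower_central.conj) auto
  have "const_lower_central m (Suc k) (\<lambda>J. comm (inv (?u J) \<otimes> ?x J \<otimes> ?u J) (?u' J)
      \<otimes> (inv (u (insert m J)) \<otimes> ?x' J \<otimes> u (insert m J)))"
    using conj u by (intro const_lower_central.mult[OF const_lower_central_comm[OF u(3) x0]
          const_lower_central.conj]) auto
  then have "const_lower_central m (Suc k) (\<lambda>J. inv (inv (?u J) \<otimes> ?x J \<otimes> ?u J) \<otimes>
      (inv (u (insert m J)) \<otimes> x (insert m J) \<otimes> u (insert m J)))"
    using conj.hyps by (simp add: comm_def word_simps)
  then show ?case
    using x0 by blast
next
  case (comm k x g)
  let ?x = "\<lambda>J. x (J - {m})" and ?x' = "\<lambda>J. inv (x (J - {m})) \<otimes> x (insert m J)"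
  have x': "const_lower_central m (Suc k) ?x'"
    using comm by simp
  have x0: "const_lower_central m (Suc k) (\<lambda>J. comm (?x J) g)"
    using comm by (intro const_lower_central.comm) auto
  have "const_lower_central m (Suc (Suc k)) (\<lambda>J. comm (comm (?x J) g) (?x' J) \<otimes> comm (?x' J) g)"
    using comm x'
    by (intro const_lower_central.mult[OF const_lower_central_comm[OF
          const_lower_central_subset[OF x'] x0]]
        const_lower_central.comm)
  then have "const_lower_central m (Suc (Suc k)) (\<lambda>J. inv (comm (?x J) g) \<otimes> comm (x (insert m J)) g)"
    using comm.hyps by (simp add: comm_def word_simps)
  then show ?case
    using x0 by blast
qed

text \<open>
  If all values but the top one are trivial, then the top value survives the differences in all
  \<open>m\<close> directions unchanged.
\<close>

lemma const_lower_central_corner: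
  assumes "const_lower_central m k x" "\<And>J. J \<subset> {..<m} \<Longrightarrow> x J = \<one>"
  shows "\<exists>y. const_lower_central 0 (k + m) y \<and> y {} = x {..<m}"
  using assms
proof (induction m arbitrary: x k)
  case 0
  then show ?case
    by auto
next
  case (Suc m)
  let ?y = "\<lambda>J. inv (x (J - {m})) \<otimes> x (insert m J)"
  have y: "const_lower_central m (Suc k) ?y"
    using const_lower_central_split[OF Suc.prems(1)] by simp
  have "?y J = \<one>" if J: "J \<subset> {..<m}" for J
  proof -
    have "J - {m} \<subset> {..<Suc m}" "insert m J \<subset> {..<Suc m}"
      using J by (auto simp: lessThan_Suc)
    then show ?thesis
      using Suc.prems(2) by simp
  qed
  then obtain z where z: "const_lower_central 0 (Suc k + m) z" "z {} = ?y {..<m}"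
    using Suc.IH[OF y] by blast
  have "x ({..<m} - {m}) = \<one>"
    by (intro Suc.prems(2)) (auto simp: lessThan_Suc)
  then have "?y {..<m} = x {..<Suc m}"
    using Suc.prems(1) by (simp add: lessThan_Suc)
  then show ?case
    using z by auto
qed

text \<open>
  In a group of class at most \<open>n\<close>, the lower central series reaches \<open>1\<close> after \<open>n\<close> steps, value by
  value.
\<close>

lemma const_lower_central_upper_central:
  assumes "upper_central n = carrier G" "const_lower_central m k x" "k \<le> n"
  shows "x J \<in> upper_central (n - k)"
  using assms(2,3)
proof (induction rule: const_lower_central.induct)
  case (comm k x g)
  then have "x J \<in> upper_central (Suc (n - Suc k))"
    by (simp add: Suc_diff_Suc)
  then show ?case
    using comm.hyps by simp
qed (auto simp: assms(1) upper_central_one upper_central_mult upper_central_conj)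

text \<open>
  The term condition of a group of class at most \<open>n\<close>: the difference in the direction \<open>n\<close> is trivial
  off the top vertex \<open>{..<n}\<close> and lies at the start of the series, and the differences in the
  \<open>n\<close> remaining directions carry its top value to the trivial term of index \<open>n\<close>.
\<close>

lemma face_words_term_condition:
  assumes "upper_central n = carrier G" "x \<in> face_words (Suc n)"
    "\<And>J. J \<subset> {..<n} \<Longrightarrow> x J = x (insert n J)"
  shows "x {..<n} = x (insert n {..<n})"
proof -
  let ?y = "\<lambda>J. inv (x (J - {n})) \<otimes> x (insert n J)"
  have "const_lower_central n 0 ?y"
    using face_words_split[OF assms(2)] by simp
  moreover have "?y J = \<one>" if "J \<subset> {..<n}" for J
  proof -
    have "J - {n} = J"
      using that by auto
    then show ?thesis
      using assms(2) assms(3)[OF that, symmetric] by simp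
  qed
  ultimately obtain z where "const_lower_central 0 n z" "z {} = ?y {..<n}"
    using const_lower_central_corner[of n 0 ?y] by auto
  then have "?y {..<n} = \<one>"
    using const_lower_central_upper_central[OF assms(1), of 0 n z "{}"] by simp
  then show ?thesis
    using assms(2) by (simp add: inv_solve_left')
qed

end

section \<open>The term condition\<close>

lemma choice_snoc:
  "length a = length b \<Longrightarrow>
    choice J (a @ [c]) (b @ [d]) = choice J a b @ [if length a \<in> J then d else c]"
  by (auto simp: choice_def nth_append)

lemma choice_cong: "(\<And>j. j < length a \<Longrightarrow> j \<in> J \<longleftrightarrow> j \<in> K) \<Longrightarrow> choice J a b = choice K a b"
  by (simp add: choice_def)

lemma choice_all: "length a = length b \<Longrightarrow> choice {..<length a} a b = b"
  by (rule nth_equalityI) (simp_all add: choice_def)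

lemma choice_insert_length: "choice (insert (length a) J) a b = choice J a b"
  by (rule choice_cong) simp

lemma list_all2_snocE:
  assumes "list_all2 P (xs @ [x]) zs"
  obtains ys y where "zs = ys @ [y]" "list_all2 P xs ys" "P x y"
  using assms by (auto simp: list_all2_append1 list_all2_Cons1)

lemma length_concat_choice:
  "list_all2 (\<lambda>x y. length x = length y) a b \<Longrightarrow> length (concat (choice J a b)) = length (concat a)"
proof (induction a arbitrary: b rule: rev_induct)
  case Nil
  then show ?case
    by (simp add: choice_def)
next
  case (snoc x a)
  from list_all2_snocE[OF snoc.prems] obtain b' y where b: "b = b' @ [y]"
      "list_all2 (\<lambda>x y. length x = length y) a b'" "length x = length y" .
  show ?case
    using snoc.IH[OF b(2)] b(3) by (simp add: b(1) choice_snoc[OF list_all2_lengthD[OF b(2)]])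
qed

text \<open>
  An entry of the list belongs to one block, so its value at the choices depends on a single
  coordinate of \<open>J\<close>.
\<close>

lemma nth_concat_choice:
  assumes "list_all2 (\<lambda>x y. length x = length y) a b" "i < length (concat a)"
  shows "\<exists>j < length a. \<exists>u v. \<forall>J. concat (choice J a b) ! i = (if j \<in> J then u else v)"
  using assms
proof (induction a arbitrary: b i rule: rev_induct)
  case Nil
  then show ?case
    by simp
next
  case (snoc x a)
  from list_all2_snocE[OF snoc.prems(1)] obtain b' y where b: "b = b' @ [y]"
      "list_all2 (\<lambda>x y. length x = length y) a b'" "length x = length y" .
  have len: "length a = length b'"
    using b(2) by (rule list_all2_lengthD)
  show ?case
  proof (cases "i < length (concat a)")
    case True
    then obtain j u v where "j < length a" "\<forall>J. concat (choice J a b') ! i = (if j \<in> J then u else v)"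
      using snoc.IH[OF b(2)] by blast
    then have "\<forall>J. concat (choice J (a @ [x]) b) ! i = (if j \<in> J then u else v)"
      using True by (simp add: b(1) choice_snoc[OF len] nth_append length_concat_choice[OF b(2)])
    then show ?thesis
      using \<open>j < length a\<close> by (metis (no_types, lifting) length_append_singleton less_SucI)
  next
    case False
    let ?i = "i - length (concat a)"
    have "\<forall>J. concat (choice J (a @ [x]) b) ! i = (if length a \<in> J then y ! ?i else x ! ?i)"
      using False by (simp add: b(1) choice_snoc[OF len] nth_append length_concat_choice[OF b(2)])
    moreover have "length a < length (a @ [x])"
      by simp
    ultimately show ?thesis
      by blast
  qed
qed

text \<open>
  The tuples \<open>c\<close> and \<open>d\<close> become one more pair of blocks, with index \<open>k\<close>, which makes the condition a
  statement about cubes of dimension \<open>k + 1\<close>.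
\<close>

lemma centralizes_UNIV_iff:
  "centralizes f (replicate k UNIV) UNIV \<delta> \<longleftrightarrow>
    (\<forall>a b p. length a = Suc k \<longrightarrow> [] \<notin> set a \<longrightarrow> list_all2 (\<lambda>x y. length x = length y) a b \<longrightarrow>
      p \<in> Pol f (length (concat a)) \<longrightarrow>
      (\<forall>J. J \<subset> {..<k} \<longrightarrow>
        (p (concat (choice J a b)), p (concat (choice (insert k J) a b))) \<in> \<delta>) \<longrightarrow>
      (p (concat (choice {..<k} a b)), p (concat (choice (insert k {..<k}) a b))) \<in> \<delta>)"
    (is "?C \<longleftrightarrow> ?D")
proof
  assume C: ?C
  show ?D
  proof (intro allI impI)
    fix a b :: "'a list list" and p
    assume a: "length a = Suc k" "[] \<notin> set a" "list_all2 (\<lambda>x y. length x = length y) a b"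
      and p: "p \<in> Pol f (length (concat a))"
      and J: "\<forall>J. J \<subset> {..<k} \<longrightarrow>
        (p (concat (choice J a b)), p (concat (choice (insert k J) a b))) \<in> \<delta>"
    obtain a' c where a': "a = a' @ [c]" "length a' = k"
      using a(1) by (metis length_Suc_conv_rev)
    from list_all2_snocE[OF a(3)[unfolded a'(1)]] obtain b' d where b': "b = b' @ [d]"
        "list_all2 (\<lambda>x y. length x = length y) a' b'" "length c = length d" .
    have len: "length a' = length b'"
      using b'(2) by (rule list_all2_lengthD)
    have ins: "choice (insert k J) a' b' = choice J a' b'" for J
      using choice_insert_length[of a'] a'(2) by simp
    have all: "choice {..<k} a' b' = b'"
      using choice_all[OF len] a'(2) by simp
    have "(p (concat b' @ c), p (concat b' @ d)) \<in> \<delta>"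
    proof (rule C[unfolded centralizes_def, rule_format, of a'])
      show "\<And>j. j < length (replicate k UNIV) \<Longrightarrow> a' ! j \<noteq> [] \<and>
          list_all2 (\<lambda>x y. (x, y) \<in> replicate k UNIV ! j) (a' ! j) (b' ! j)"
        using a a' b' by (auto simp: list_all2_conv_all_nth in_set_conv_nth)
      show "(p (concat (choice J a' b') @ c), p (concat (choice J a' b') @ d)) \<in> \<delta>"
        if "J \<subset> {..<length (replicate k (UNIV :: 'a rel))}" for J
      proof -
        have "k \<notin> J"
          using that by auto
        then show ?thesis
          using J[rule_format, of J] that a' b' by (simp add: choice_snoc[OF len] ins)
      qed
    qed (use a a' b' p len in \<open>auto simp: list_all2_conv_all_nth\<close>)
    then show "(p (concat (choice {..<k} a b)), p (concat (choice (insert k {..<k}) a b))) \<in> \<delta>"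
      using a' b' by (simp add: choice_snoc[OF len] ins all)
  qed
next
  assume D: ?D
  show ?C
    unfolding centralizes_def
  proof (intro allI impI)
    fix a b :: "'a list list" and c d p
    assume a: "length a = length (replicate k (UNIV :: 'a rel))"
      and b: "length b = length (replicate k (UNIV :: 'a rel))"
      and ab: "\<forall>j<length (replicate k UNIV). a ! j \<noteq> [] \<and>
          list_all2 (\<lambda>x y. (x, y) \<in> replicate k UNIV ! j) (a ! j) (b ! j)"
      and c: "c \<noteq> []" and cd: "list_all2 (\<lambda>x y. (x, y) \<in> (UNIV :: 'a rel)) c d"
      and p: "p \<in> Pol f (length (concat a) + length c)"
      and J: "\<forall>J. J \<subset> {..<length (replicate k (UNIV :: 'a rel))} \<longrightarrow>
        (p (concat (choice J a b) @ c), p (concat (choice J a b) @ d)) \<in> \<delta>"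
    have len: "length a = length b"
      using a b by simp
    have ins: "choice (insert k J) a b = choice J a b" for J
      using choice_insert_length[of a] a by simp
    have all: "choice {..<k} a b = b"
      using choice_all[OF len] a by simp
    have "(p (concat (choice {..<k} (a @ [c]) (b @ [d]))),
        p (concat (choice (insert k {..<k}) (a @ [c]) (b @ [d])))) \<in> \<delta>"
    proof (rule D[rule_format])
      show "list_all2 (\<lambda>x y. length x = length y) (a @ [c]) (b @ [d])"
        using a b ab cd by (auto simp: list_all2_conv_all_nth nth_append)
      show "[] \<notin> set (a @ [c])"
        using a ab c by (auto simp: in_set_conv_nth)
      show "(p (concat (choice J (a @ [c]) (b @ [d]))),
          p (concat (choice (insert k J) (a @ [c]) (b @ [d])))) \<in> \<delta>"
        if "J \<subset> {..<k}" for J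
      proof -
        have "k \<notin> J"
          using that by auto
        then show ?thesis
          using J[rule_format, of J] that a by (simp add: choice_snoc[OF len] ins)
      qed
    qed (use a p in auto)
    then show "(p (concat b @ c), p (concat b @ d)) \<in> \<delta>"
      using a by (simp add: choice_snoc[OF len] ins all)
  qed
qed

lemma centralizes_mono:
  assumes C: "centralizes f \<alpha>s \<beta> \<delta>" and \<alpha>: "list_all2 (\<subseteq>) \<alpha>s' \<alpha>s" and \<beta>: "\<beta>' \<subseteq> \<beta>"
  shows "centralizes f \<alpha>s' \<beta>' \<delta>"
  unfolding centralizes_def
proof (intro allI impI)
  fix a b c d p
  assume len: "length a = length \<alpha>s'" "length b = length \<alpha>s'"
    and ab: "\<forall>j<length \<alpha>s'. a ! j \<noteq> [] \<and> list_all2 (\<lambda>x y. (x, y) \<in> \<alpha>s' ! j) (a ! j) (b ! j)"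
    and c: "c \<noteq> []" and cd: "list_all2 (\<lambda>x y. (x, y) \<in> \<beta>') c d"
    and p: "p \<in> Pol f (length (concat a) + length c)"
    and J: "\<forall>J. J \<subset> {..<length \<alpha>s'} \<longrightarrow>
        (p (concat (choice J a b) @ c), p (concat (choice J a b) @ d)) \<in> \<delta>"
  note len_\<alpha> = list_all2_lengthD[OF \<alpha>]
  show "(p (concat b @ c), p (concat b @ d)) \<in> \<delta>"
  proof (rule C[unfolded centralizes_def, rule_format, OF _ _ _ c _ p])
    show "a ! j \<noteq> [] \<and> list_all2 (\<lambda>x y. (x, y) \<in> \<alpha>s ! j) (a ! j) (b ! j)"
      if "j < length \<alpha>s" for j
    proof -
      have "\<alpha>s' ! j \<subseteq> \<alpha>s ! j"
        using that len_\<alpha> by (intro list_all2_nthD[OF \<alpha>]) simp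
      moreover have "a ! j \<noteq> []" "list_all2 (\<lambda>x y. (x, y) \<in> \<alpha>s' ! j) (a ! j) (b ! j)"
        using ab that len_\<alpha> by simp_all
      ultimately show ?thesis
        by (auto elim!: list_all2_mono)
    qed
    show "list_all2 (\<lambda>x y. (x, y) \<in> \<beta>) c d"
      using cd by (rule list_all2_mono) (use \<beta> in blast)
  qed (use len len_\<alpha> J in simp_all)
qed

lemma centralizes_single_iff:
  "centralizes f [UNIV] \<beta> \<delta> \<longleftrightarrow>
    (\<forall>(a :: 'a list) b c d p. a \<noteq> [] \<longrightarrow> length a = length b \<longrightarrow> c \<noteq> [] \<longrightarrow> list_all2 (\<lambda>x y. (x, y) \<in> \<beta>) c d \<longrightarrow>
      p \<in> Pol f (length a + length c) \<longrightarrow> (p (a @ c), p (a @ d)) \<in> \<delta> \<longrightarrow>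
      (p (b @ c), p (b @ d)) \<in> \<delta>)" (is "?C \<longleftrightarrow> ?D")
proof
  have none: "choice {} [x] [y] = [x]" for x y :: "'a list"
    by (simp add: choice_def)
  assume C: ?C
  show ?D
  proof (intro allI impI)
    fix a b c d :: "'a list" and p
    assume *: "a \<noteq> []" "length a = length b" "c \<noteq> []" "list_all2 (\<lambda>x y. (x, y) \<in> \<beta>) c d"
      "p \<in> Pol f (length a + length c)" "(p (a @ c), p (a @ d)) \<in> \<delta>"
    have "(p (concat [b] @ c), p (concat [b] @ d)) \<in> \<delta>"
    proof (rule C[unfolded centralizes_def, rule_format, OF _ _ _ *(3,4)])
      show "(p (concat (choice J [a] [b]) @ c), p (concat (choice J [a] [b]) @ d)) \<in> \<delta>"
        if "J \<subset> {..<length [UNIV :: 'a rel]}" for J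
      proof -
        have "J = {}"
          using that by auto
        then show ?thesis
          using * none by simp
      qed
    qed (use * in \<open>simp_all add: list_all2_same list_all2_conv_all_nth\<close>)
    then show "(p (b @ c), p (b @ d)) \<in> \<delta>"
      by simp
  qed
next
  assume D: ?D
  show ?C
    unfolding centralizes_def
  proof (intro allI impI)
    fix a b :: "'a list list" and c d p
    assume a: "length a = length [UNIV :: 'a rel]" and b: "length b = length [UNIV :: 'a rel]"
      and ab: "\<forall>j<length [UNIV]. a ! j \<noteq> [] \<and>
          list_all2 (\<lambda>x y. (x, y) \<in> [UNIV] ! j) (a ! j) (b ! j)"
      and c: "c \<noteq> []" "list_all2 (\<lambda>x y. (x, y) \<in> \<beta>) c d"
      and p: "p \<in> Pol f (length (concat a) + length c)"
      and J: "\<forall>J. J \<subset> {..<length [UNIV :: 'a rel]} \<longrightarrow>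
        (p (concat (choice J a b) @ c), p (concat (choice J a b) @ d)) \<in> \<delta>"
    obtain x y where xy: "a = [x]" "b = [y]"
      using a b by (auto simp: length_Suc_conv)
    have "{} \<subset> {..<length [UNIV :: 'a rel]}"
      by auto
    then have "(p (x @ c), p (x @ d)) \<in> \<delta>"
      using J[rule_format, of "{}"] xy by (simp add: choice_def)
    moreover have "x \<noteq> []" "length x = length y"
      using ab xy by (auto dest: list_all2_lengthD)
    ultimately have "(p (y @ c), p (y @ d)) \<in> \<delta>"
      using D c p xy by simp
    then show "(p (concat b @ c), p (concat b @ d)) \<in> \<delta>"
      using xy by simp
  qed
qed

lemma congruence_refl: "congruence f \<delta> \<Longrightarrow> (x, x) \<in> \<delta>"
  by (simp add: congruence_def equiv_def refl_on_def)

lemma congruence_sym: "congruence f \<delta> \<Longrightarrow> (x, y) \<in> \<delta> \<Longrightarrow> (y, x) \<in> \<delta>"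
  unfolding congruence_def equiv_def by (meson symD)

lemma congruence_trans: "congruence f \<delta> \<Longrightarrow> (x, y) \<in> \<delta> \<Longrightarrow> (y, z) \<in> \<delta> \<Longrightarrow> (x, z) \<in> \<delta>"
  unfolding congruence_def equiv_def by (meson transD)

lemma congruence_mult:
  "congruence f \<delta> \<Longrightarrow> (x, y) \<in> \<delta> \<Longrightarrow> (u, v) \<in> \<delta> \<Longrightarrow> (f x u, f y v) \<in> \<delta>"
  by (simp add: congruence_def)

lemma congruenceI:
  assumes "\<And>x. (x, x) \<in> \<delta>" "\<And>x y. (x, y) \<in> \<delta> \<Longrightarrow> (y, x) \<in> \<delta>"
    "\<And>x y z. (x, y) \<in> \<delta> \<Longrightarrow> (y, z) \<in> \<delta> \<Longrightarrow> (x, z) \<in> \<delta>"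
    "\<And>x y u v. (x, y) \<in> \<delta> \<Longrightarrow> (u, v) \<in> \<delta> \<Longrightarrow> (f x u, f y v) \<in> \<delta>"
  shows "congruence f \<delta>"
  unfolding congruence_def
proof (intro conjI equivI)
  show "refl_on UNIV \<delta>"
    using assms(1) by (simp add: refl_on_def)
  show "sym \<delta>"
    by (rule symI) (rule assms(2))
  show "trans \<delta>"
    by (rule transI) (rule assms(3))
  show "\<forall>x y u v. (x, y) \<in> \<delta> \<longrightarrow> (u, v) \<in> \<delta> \<longrightarrow> (f x u, f y v) \<in> \<delta>"
    using assms(4) by blast
qed simp

lemma central_series_congruence: "congruence f (central_series f k)"
  by (cases k) (auto intro: commutator_congruence congruenceI)

lemma central_series_centralizes: "centralizes f [UNIV] (central_series f k) (central_series f (Suc k))"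
  using commutator_centralizes[of f "[UNIV, central_series f k]"] by simp

lemma supernilpotent_centralizes:
  fixes f :: "'a \<Rightarrow> 'a \<Rightarrow> 'a"
  assumes "supernilpotent f n"
  shows "centralizes f (replicate n UNIV) UNIV Id"
proof -
  have "replicate (n + 1) (UNIV :: 'a rel) = replicate n UNIV @ [UNIV]"
    by (simp add: replicate_append_same)
  then show ?thesis
    using assms commutator_centralizes[of f "replicate n UNIV @ [UNIV]"]
    by (simp add: supernilpotent_def)
qed

text \<open>
  Modulo \<open>\<delta>\<close> a product is its first factor, or modulo \<open>\<delta>\<close> it is its last factor.
\<close>

lemma Pol_projection:
  assumes \<delta>: "congruence f \<delta>" and proj: "(\<forall>x y. (f x y, x) \<in> \<delta>) \<or> (\<forall>x y. (f x y, y) \<in> \<delta>)"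
    and "p \<in> Pol f N"
  shows "(\<exists>i<N. \<forall>x. (p x, x ! i) \<in> \<delta>) \<or> (\<exists>a. \<forall>x. (p x, a) \<in> \<delta>)"
  using assms(3)
proof (induction rule: Pol.induct)
  case (Pol_mult p q)
  show ?case
  proof (cases "\<forall>x y. (f x y, x) \<in> \<delta>")
    case True
    then have "(f (p x) (q x), y) \<in> \<delta>" if "(p x, y) \<in> \<delta>" for x y
      using congruence_trans[OF \<delta> _ that] by blast
    then show ?thesis
      using Pol_mult.IH(1) by metis
  next
    case False
    then have "(f (p x) (q x), y) \<in> \<delta>" if "(q x, y) \<in> \<delta>" for x y
      using proj congruence_trans[OF \<delta> _ that] by blast
    then show ?thesis
      using Pol_mult.IH(2) by metis
  qed
qed (auto intro: congruence_refl[OF \<delta>])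

text \<open>
  For a polynomial that is a single variable modulo \<open>\<delta>\<close>, only the case that the variable belongs to
  the last block needs an argument: then the premise for \<open>J = {}\<close> already is the conclusion. The
  choice \<open>J = {}\<close> is not the excluded one, since \<open>\<alpha>s\<close> is not empty.
\<close>

lemma centralizes_projection:
  fixes f :: "'a \<Rightarrow> 'a \<Rightarrow> 'a"
  assumes \<delta>: "congruence f \<delta>" and proj: "(\<forall>x y. (f x y, x) \<in> \<delta>) \<or> (\<forall>x y. (f x y, y) \<in> \<delta>)"
    and "\<alpha>s \<noteq> []"
  shows "centralizes f \<alpha>s \<beta> \<delta>"
proof (rule centralizes_mono[of f "replicate (length \<alpha>s) UNIV" UNIV];
    (unfold centralizes_UNIV_iff, intro allI impI)?)
  fix a b :: "'a list list" and p :: "'a list \<Rightarrow> 'a"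
  let ?k = "length \<alpha>s"
  let ?p = "\<lambda>J. p (concat (choice J a b))"
  assume a: "length a = Suc ?k" and ab: "list_all2 (\<lambda>x y. length x = length y) a b"
    and p: "p \<in> Pol f (length (concat a))"
    and J: "\<forall>J. J \<subset> {..<?k} \<longrightarrow> (?p J, ?p (insert ?k J)) \<in> \<delta>"
  have related: "(?p J, ?p K) \<in> \<delta>" if "(?p J, x) \<in> \<delta>" "(?p K, x) \<in> \<delta>" for J K x
    using congruence_trans[OF \<delta> that(1)] congruence_sym[OF \<delta> that(2)] by simp
  consider (var) i where "i < length (concat a)" "\<And>x. (p x, x ! i) \<in> \<delta>"
    | (const) c where "\<And>x. (p x, c) \<in> \<delta>"
    using Pol_projection[OF \<delta> proj p] by blast
  then show "(?p {..<?k}, ?p (insert ?k {..<?k})) \<in> \<delta>"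
  proof cases
    case var
    obtain j u v where "j < length a" and
        eq: "\<And>J. concat (choice J a b) ! i = (if j \<in> J then u else v)"
      using nth_concat_choice[OF ab var(1)] by blast
    have val: "(?p J, if j \<in> J then u else v) \<in> \<delta>" for J
      using var(2)[of "concat (choice J a b)"] eq[of J] by simp
    show ?thesis
    proof (cases "j = ?k")
      case True
      have "{} \<subset> {..<?k}"
        using assms(3) by auto
      then have "(?p {}, ?p {?k}) \<in> \<delta>"
        using J by blast
      then have "(?p {}, u) \<in> \<delta>"
        using congruence_trans[OF \<delta> _ val[of "{?k}"]] True by simp
      then have "(v, u) \<in> \<delta>"
        using congruence_trans[OF \<delta> congruence_sym[OF \<delta> val[of "{}"]]] by simp
      then have "(?p {..<?k}, u) \<in> \<delta>"
        using congruence_trans[OF \<delta> val[of "{..<?k}"]] True by simp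
      then show ?thesis
        using related val[of "insert ?k {..<?k}"] True by simp
    next
      case False
      then show ?thesis
        using related[OF val[of "{..<?k}"]] val[of "insert ?k {..<?k}"] by simp
    qed
  next
    case const
    then show ?thesis
      using related by blast
  qed
qed (simp_all add: list_all2_conv_all_nth)

section \<open>Rectangular bands of idempotents\<close>

text \<open>
  The word that compares idempotents: \<open>x\<^sub>0 x\<^sub>1 \<dots> x\<^sub>j\<close>, bracketed to the left.
\<close>

lemma Pol_nth_product: "j < N \<Longrightarrow> (\<lambda>x. foldl f (x ! 0) (map ((!) x) [1..<Suc j])) \<in> Pol f N"
proof (induction j)
  case 0
  then show ?case
    by (simp add: Pol_var)
next
  case (Suc j)
  have "(\<lambda>x. f (foldl f (x ! 0) (map ((!) x) [1..<Suc j])) (x ! Suc j)) \<in> Pol f N"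
    using Suc by (intro Pol_mult Pol_var) auto
  then show ?case
    by simp
qed

text \<open>
  The pair \<open>(g, k)\<close> stays in all terms of the central series: \<open>k g = k = k k\<close>, so the term condition
  for \<open>x y\<close> relates \<open>g g = g\<close> to \<open>g k = k\<close>.
\<close>

lemma nilpotent_below_idempotent:
  assumes "nilpotent f n" and k: "f g g = g" "f g k = k" "f k g = k" "f k k = k"
  shows "k = g"
proof -
  have "(g, k) \<in> central_series f i" for i
  proof (induction i)
    case (Suc i)
    let ?p = "\<lambda>x. f (x ! 0) (x ! 1)"
    have p: "?p \<in> Pol f (length [k] + length [g])"
      by (intro Pol_mult Pol_var) auto
    have "(?p ([g] @ [g]), ?p ([g] @ [k])) \<in> central_series f (Suc i)"
      by (rule central_series_centralizes[unfolded centralizes_single_iff, rule_format, OF _ _ _ _ p])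
        (use Suc k in \<open>simp_all add: congruence_refl[OF commutator_congruence]\<close>)
    then show ?case
      using k by simp
  qed simp
  then show ?thesis
    using assms(1) by (auto simp: nilpotent_def)
qed

text \<open>
  The product \<open>x\<^sub>0 \<dots> x\<^sub>n\<close> over \<open>{g, k}\<close> equals \<open>k\<close> as soon as one of the factors is \<open>k\<close>. At every
  choice that is not excluded, some \<open>x\<^sub>j\<close> with \<open>j < n\<close> is \<open>k\<close>, so the term condition compares
  \<open>g \<dots> g k = k\<close> with \<open>g \<dots> g g = g\<close>.
\<close>

lemma supernilpotent_below_idempotent:
  assumes "supernilpotent f n" "n \<ge> 1" and k: "f g g = g" "f g k = k" "f k g = k" "f k k = k"
  shows "k = g"
proof -
  let ?x = "\<lambda>J. concat (choice J (replicate (Suc n) [k]) (replicate (Suc n) [g]))"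
  let ?p = "\<lambda>x. foldl f (x ! 0) (map ((!) x) [1..<Suc n])"
  have x: "?x J = map (\<lambda>j. if j \<in> J then g else k) [0..<Suc n]" for J
  proof -
    have "choice J (replicate (Suc n) [k]) (replicate (Suc n) [g])
        = map (\<lambda>j. [if j \<in> J then g else k]) [0..<Suc n]"
      by (auto simp: choice_def simp del: replicate_Suc upt_Suc)
    also have "concat \<dots> = map (\<lambda>j. if j \<in> J then g else k) [0..<Suc n]"
      by (rule concat_map_singleton)
    finally show ?thesis .
  qed
  have nth: "?x J ! j = (if j \<in> J then g else k)" if "j \<le> n" for J j
    unfolding x using that by (simp add: less_Suc_eq_le del: upt_Suc)
  have foldl: "foldl f (?x J ! 0) (map ((!) (?x J)) [1..<Suc j]) = (if {..j} \<subseteq> J then g else k)"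
    if "j \<le> n" for J j
    using that
  proof (induction j)
    case 0
    have "[1..<Suc 0] = []" "({..0::nat} \<subseteq> J) = (0 \<in> J)"
      by auto
    then show ?case
      using nth[of 0 J] by (simp only: list.map foldl_Nil)
  next
    case (Suc j)
    have "foldl f (?x J ! 0) (map ((!) (?x J)) [1..<Suc (Suc j)]) =
        f (foldl f (?x J ! 0) (map ((!) (?x J)) [1..<Suc j])) (?x J ! Suc j)"
      by (simp del: replicate_Suc)
    also have "\<dots> = f (if {..j} \<subseteq> J then g else k) (if Suc j \<in> J then g else k)"
      using Suc nth[of "Suc j" J] by (simp only: Suc_leD)
    also have "\<dots> = (if {..Suc j} \<subseteq> J then g else k)"
      using k by (simp add: atMost_Suc)
    finally show ?case .
  qed
  have p: "?p (?x J) = (if {..n} \<subseteq> J then g else k)" for J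
    by (rule foldl) simp
  have "(?p (?x {..<n}), ?p (?x (insert n {..<n}))) \<in> Id"
  proof (rule supernilpotent_centralizes[OF assms(1), unfolded centralizes_UNIV_iff, rule_format])
    show "?p \<in> Pol f (length (concat (replicate (Suc n) [k])))"
      by (rule Pol_nth_product) (simp add: length_concat sum_list_replicate)
    show "(?p (?x J), ?p (?x (insert n J))) \<in> Id" if "J \<subset> {..<n}" for J
    proof -
      obtain i where "i < n" "i \<notin> J"
        using \<open>J \<subset> {..<n}\<close> by blast
      then have "i \<in> {..n}" "i \<notin> J" "i \<notin> insert n J"
        by auto
      then have "\<not> {..n} \<subseteq> J" "\<not> {..n} \<subseteq> insert n J"
        by blast+
      then show ?thesis
        by (simp only: p if_False) simp
    qed
  qed (auto simp: list_all2_conv_all_nth simp del: replicate_Suc)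
  moreover have "\<not> {..n} \<subseteq> {..<n}" "{..n} \<subseteq> insert n {..<n}"
    by auto
  ultimately show ?thesis
    by (simp only: p if_False if_True) simp
qed

lemma (in regular_semigroup) weak_inverse:
  obtains y where "x \<^bold>* y \<^bold>* x = x"
    "(x \<^bold>* y) \<^bold>* (x \<^bold>* y) = x \<^bold>* y" "(y \<^bold>* x) \<^bold>* (y \<^bold>* x) = y \<^bold>* x"
proof -
  obtain y where y: "x \<^bold>* y \<^bold>* x = x"
    using regular by blast
  have "(x \<^bold>* y) \<^bold>* (x \<^bold>* y) = (x \<^bold>* y \<^bold>* x) \<^bold>* y" "(y \<^bold>* x) \<^bold>* (y \<^bold>* x) = y \<^bold>* (x \<^bold>* y \<^bold>* x)"
    by (simp_all only: assoc)
  then show thesis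
    by (intro that[OF y]) (simp_all only: y)
qed

text \<open>
  These are the semigroups isomorphic to a product of a left zero semigroup, a group and a right zero
  semigroup, together with a chosen idempotent. There the idempotents are the triples \<open>(l, 1, r)\<close>,
  and a middle factor of a product contributes only its group component, which gives \<open>absorb\<close>.
\<close>

locale rectangular_group = regular_semigroup +
  fixes e :: 'a
  assumes idem_e: "e \<^bold>* e = e"
    and absorb: "u \<^bold>* u = u \<Longrightarrow> x \<^bold>* (u \<^bold>* y) = x \<^bold>* y"

text \<open>
  The hypothesis says that no idempotent lies strictly below another one. As \<open>g h g \<le> g\<close> for
  idempotents, they form a rectangular band, in which \<open>g u h = g h\<close>. This extends to all elements,
  because \<open>x = x (x' x)\<close> and \<open>y = (y y') y\<close> with \<open>x' x\<close> and \<open>y y'\<close> idempotent.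
\<close>

lemma (in orthodox_semigroup) rectangular_groupI:
  assumes below: "\<And>g k. g \<^bold>* g = g \<Longrightarrow> g \<^bold>* k = k \<Longrightarrow> k \<^bold>* g = k \<Longrightarrow> k \<^bold>* k = k \<Longrightarrow> k = g"
  shows "\<exists>e. rectangular_group f e"
proof -
  obtain e where e: "e \<^bold>* e = e"
    using weak_inverse by blast
  have rectangular: "g \<^bold>* (h \<^bold>* g) = g" if "g \<^bold>* g = g" "h \<^bold>* h = h" for g h
  proof (rule below[OF that(1)])
    have "(g \<^bold>* h) \<^bold>* g \<^bold>* ((g \<^bold>* h) \<^bold>* g) = (g \<^bold>* h) \<^bold>* g"
      by (intro idempotents_closed that)
    then show "g \<^bold>* (h \<^bold>* g) \<^bold>* (g \<^bold>* (h \<^bold>* g)) = g \<^bold>* (h \<^bold>* g)"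
      by (simp add: assoc)
    show "g \<^bold>* (g \<^bold>* (h \<^bold>* g)) = g \<^bold>* (h \<^bold>* g)"
      using that(1) by (simp flip: assoc)
    show "g \<^bold>* (h \<^bold>* g) \<^bold>* g = g \<^bold>* (h \<^bold>* g)"
      using that(1) by (simp add: assoc)
  qed
  have absorb_idem: "g \<^bold>* (u \<^bold>* h) = g \<^bold>* h"
    if g: "g \<^bold>* g = g" and u: "u \<^bold>* u = u" and h: "h \<^bold>* h = h" for g u h
  proof -
    have "g \<^bold>* (u \<^bold>* h) = g \<^bold>* (h \<^bold>* g) \<^bold>* (u \<^bold>* h)"
      by (simp only: rectangular[OF g h])
    also have "\<dots> = g \<^bold>* (h \<^bold>* ((g \<^bold>* u) \<^bold>* h))"
      by (simp only: assoc)
    also have "\<dots> = g \<^bold>* h"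
      by (simp only: rectangular[OF h idempotents_closed[OF g u]])
    finally show ?thesis .
  qed
  have "x \<^bold>* (u \<^bold>* y) = x \<^bold>* y" if "u \<^bold>* u = u" for x u y
  proof -
    obtain x' where x: "x \<^bold>* x' \<^bold>* x = x" "(x' \<^bold>* x) \<^bold>* (x' \<^bold>* x) = x' \<^bold>* x"
      using weak_inverse by blast
    obtain y' where y: "y \<^bold>* y' \<^bold>* y = y" "(y \<^bold>* y') \<^bold>* (y \<^bold>* y') = y \<^bold>* y'"
      using weak_inverse by blast
    have "x \<^bold>* (u \<^bold>* y) = x \<^bold>* x' \<^bold>* x \<^bold>* (u \<^bold>* (y \<^bold>* y' \<^bold>* y))"
      by (simp only: x y)
    also have "\<dots> = x \<^bold>* (((x' \<^bold>* x) \<^bold>* (u \<^bold>* (y \<^bold>* y'))) \<^bold>* y)"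
      by (simp only: assoc)
    also have "\<dots> = x \<^bold>* (((x' \<^bold>* x) \<^bold>* (y \<^bold>* y')) \<^bold>* y)"
      by (simp only: absorb_idem[OF x(2) that y(2)])
    also have "\<dots> = x \<^bold>* x' \<^bold>* x \<^bold>* (y \<^bold>* y' \<^bold>* y)"
      by (simp only: assoc)
    finally show ?thesis
      by (simp only: x y)
  qed
  then show ?thesis
    using e by (intro exI[of _ e]) unfold_locales
qed

section \<open>Rectangular groups\<close>

context rectangular_group
begin

text \<open>
  The projection to the group factor, which is realized as \<open>e S e\<close>.
\<close>

definition core :: "'a \<Rightarrow> 'a" where
  "core x = e \<^bold>* (x \<^bold>* e)"

definition G :: "'a monoid" where
  "G = \<lparr>carrier = range core, mult = (\<^bold>*), one = e\<rparr>"

lemma mult_G [simp]: "x \<otimes>\<^bsub>G\<^esub> y = x \<^bold>* y" and one_G [simp]: "\<one>\<^bsub>G\<^esub> = e"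
  by (simp_all add: G_def)

lemma core_in_G [simp]: "core x \<in> carrier G"
  by (simp add: G_def)

lemma core_mult: "core (x \<^bold>* y) = core x \<^bold>* core y"
  by (simp add: core_def assoc absorb idem_e)

lemma core_core [simp]: "core (core x) = core x"
  by (simp add: core_def assoc idem_e) (simp add: idem_e flip: assoc)

lemma core_e [simp]: "core e = e"
  by (simp add: core_def idem_e)

lemma core_idem: "u \<^bold>* u = u \<Longrightarrow> core u = e"
  by (simp add: core_def absorb idem_e)

lemma core_G: "x \<in> carrier G \<Longrightarrow> core x = x"
  by (auto simp: G_def)

sublocale G: group G
proof (rule groupI)
  fix x y z
  assume x: "x \<in> carrier G" and y: "y \<in> carrier G"
  have "x \<^bold>* y = core (x \<^bold>* y)"
    using x y by (simp add: core_mult core_G)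
  then show "x \<otimes>\<^bsub>G\<^esub> y \<in> carrier G"
    using core_in_G[of "x \<^bold>* y"] by simp
  show "x \<otimes>\<^bsub>G\<^esub> y \<otimes>\<^bsub>G\<^esub> z = x \<otimes>\<^bsub>G\<^esub> (y \<otimes>\<^bsub>G\<^esub> z)"
    by (simp add: assoc)
next
  show "\<one>\<^bsub>G\<^esub> \<in> carrier G"
    using core_in_G[of e] by simp
next
  fix x
  assume "x \<in> carrier G"
  then obtain y where y: "x = core y"
    by (auto simp: G_def)
  show "\<one>\<^bsub>G\<^esub> \<otimes>\<^bsub>G\<^esub> x = x"
    by (simp add: y core_def idem_e flip: assoc)
  obtain y' where "(y' \<^bold>* y) \<^bold>* (y' \<^bold>* y) = y' \<^bold>* y"
    using weak_inverse by blast
  then have "core y' \<^bold>* x = e"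
    using core_idem y by (simp flip: core_mult)
  then show "\<exists>y\<in>carrier G. y \<otimes>\<^bsub>G\<^esub> x = \<one>\<^bsub>G\<^esub>"
    by (intro bexI[of _ "core y'"]) simp_all
qed

text \<open>From here on, products in \<open>G\<close> are kept in the group notation, where the word rules apply.\<close>

declare mult_G [simp del] one_G [simp del]

lemma core_mult_G: "core (x \<^bold>* y) = core x \<otimes>\<^bsub>G\<^esub> core y"
  by (simp add: core_mult mult_G)

text \<open>
  The Green relations \<open>R\<close> and \<open>L\<close>. In a rectangular group they are equality of the left and of the
  right factor.
\<close>

definition left_rel :: "'a rel" where
  "left_rel = {(s, t). (\<exists>x. s = t \<^bold>* x) \<and> (\<exists>y. t = s \<^bold>* y)}"

definition right_rel :: "'a rel" where
  "right_rel = {(s, t). (\<exists>x. s = x \<^bold>* t) \<and> (\<exists>y. t = y \<^bold>* s)}"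

lemma left_rel_mult: "(x \<^bold>* y, x) \<in> left_rel"
proof -
  obtain x' where x: "x \<^bold>* x' \<^bold>* x = x"
    using weak_inverse by blast
  obtain y' where y: "(y \<^bold>* y') \<^bold>* (y \<^bold>* y') = y \<^bold>* y'"
    using weak_inverse by blast
  have "x \<^bold>* y \<^bold>* (y' \<^bold>* (x' \<^bold>* x)) = x \<^bold>* ((y \<^bold>* y') \<^bold>* (x' \<^bold>* x))"
    by (simp only: assoc)
  also have "\<dots> = x"
    using x by (simp add: absorb[OF y]) (simp add: assoc)
  finally have "x = x \<^bold>* y \<^bold>* (y' \<^bold>* (x' \<^bold>* x))"
    by simp
  then show ?thesis
    by (auto simp: left_rel_def)
qed

lemma right_rel_mult: "(x \<^bold>* y, y) \<in> right_rel"
proof -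
  obtain y' where y: "y \<^bold>* y' \<^bold>* y = y"
    using weak_inverse by blast
  obtain x' where x: "(x' \<^bold>* x) \<^bold>* (x' \<^bold>* x) = x' \<^bold>* x"
    using weak_inverse by blast
  have "y \<^bold>* y' \<^bold>* x' \<^bold>* (x \<^bold>* y) = (y \<^bold>* y') \<^bold>* ((x' \<^bold>* x) \<^bold>* y)"
    by (simp only: assoc)
  also have "\<dots> = y"
    using y by (simp add: absorb[OF x])
  finally have "y = y \<^bold>* y' \<^bold>* x' \<^bold>* (x \<^bold>* y)"
    by simp
  then show ?thesis
    by (auto simp: right_rel_def)
qed

lemma left_rel_congruence: "congruence f left_rel"
proof (rule congruenceI)
  show refl: "(x, x) \<in> left_rel" for x
  proof -
    obtain x' where "x \<^bold>* x' \<^bold>* x = x"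
      using weak_inverse by blast
    then have "x = x \<^bold>* (x' \<^bold>* x)"
      by (simp add: assoc)
    then show ?thesis
      unfolding left_rel_def by blast
  qed
  show sym: "(y, x) \<in> left_rel" if "(x, y) \<in> left_rel" for x y
    using that by (auto simp: left_rel_def)
  show trans: "(x, z) \<in> left_rel" if "(x, y) \<in> left_rel" "(y, z) \<in> left_rel" for x y z
  proof -
    have "\<exists>x. r = t \<^bold>* x" if "\<exists>x. r = s \<^bold>* x" "\<exists>x. s = t \<^bold>* x" for r s t
      using that by (auto simp: assoc)
    then show ?thesis
      using that unfolding left_rel_def by blast
  qed
  show "(x \<^bold>* u, y \<^bold>* v) \<in> left_rel" if "(x, y) \<in> left_rel" for x y u v
    using trans[OF trans[OF left_rel_mult that] sym[OF left_rel_mult]] .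
qed

lemma right_rel_congruence: "congruence f right_rel"
proof (rule congruenceI)
  show refl: "(x, x) \<in> right_rel" for x
  proof -
    obtain x' where "x \<^bold>* x' \<^bold>* x = x"
      using weak_inverse by blast
    then have "x = (x \<^bold>* x') \<^bold>* x"
      by (simp add: assoc)
    then show ?thesis
      unfolding right_rel_def by blast
  qed
  show sym: "(y, x) \<in> right_rel" if "(x, y) \<in> right_rel" for x y
    using that by (auto simp: right_rel_def)
  show trans: "(x, z) \<in> right_rel" if "(x, y) \<in> right_rel" "(y, z) \<in> right_rel" for x y z
  proof -
    have "\<exists>x. r = x \<^bold>* t" if "\<exists>x. r = x \<^bold>* s" "\<exists>x. s = x \<^bold>* t" for r s t
      using that by (auto simp flip: assoc)
    then show ?thesis
      using that unfolding right_rel_def by blast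
  qed
  show "(x \<^bold>* u, y \<^bold>* v) \<in> right_rel" if "(u, v) \<in> right_rel" for x y u v
    using trans[OF trans[OF right_rel_mult that] sym[OF right_rel_mult]] .
qed

lemma commutator_left_right:
  assumes "length \<alpha>s \<ge> 2"
  shows "commutator f \<alpha>s \<subseteq> left_rel \<inter> right_rel"
proof -
  have "butlast \<alpha>s \<noteq> []"
    using assms by (cases \<alpha>s) auto
  then have "centralizes f (butlast \<alpha>s) (last \<alpha>s) left_rel"
    "centralizes f (butlast \<alpha>s) (last \<alpha>s) right_rel"
    using left_rel_mult right_rel_mult
    by (auto intro!: centralizes_projection left_rel_congruence right_rel_congruence)
  then show ?thesis
    by (intro Int_greatest commutator_minimal left_rel_congruence right_rel_congruence)
qed

text \<open>
  An element is determined by its three factors: if \<open>s\<close> and \<open>t\<close> generate the same right ideal and the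
  same left ideal, then \<open>s = t t' s t' t\<close>, and the idempotent \<open>e\<close> may be inserted on both sides of
  \<open>s\<close>, so that \<open>s\<close> enters only through its core.
\<close>

lemma left_right_core_eq:
  assumes "(s, t) \<in> left_rel" "(s, t) \<in> right_rel" "core s = core t"
  shows "s = t"
proof -
  have "\<exists>x. s = t \<^bold>* x" "\<exists>y. s = y \<^bold>* t"
    using assms(1,2) by (simp_all add: left_rel_def right_rel_def)
  then obtain x y where x: "s = t \<^bold>* x" and y: "s = y \<^bold>* t"
    by blast
  obtain t' where t: "t \<^bold>* t' \<^bold>* t = t"
    using weak_inverse by blast
  have expand: "t \<^bold>* t' \<^bold>* (core u \<^bold>* (t' \<^bold>* t)) = t \<^bold>* t' \<^bold>* (u \<^bold>* (t' \<^bold>* t))" for u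
    by (simp add: core_def assoc absorb idem_e)
  have "t \<^bold>* t' \<^bold>* t \<^bold>* x = t \<^bold>* t' \<^bold>* (t \<^bold>* x)" "y \<^bold>* (t \<^bold>* t' \<^bold>* t) = (y \<^bold>* t) \<^bold>* (t' \<^bold>* t)"
    by (simp_all only: assoc)
  then have left: "t \<^bold>* t' \<^bold>* s = s" and right: "s \<^bold>* (t' \<^bold>* t) = s"
    using x y by (simp_all only: t)
  have "s = t \<^bold>* t' \<^bold>* (s \<^bold>* (t' \<^bold>* t))"
    by (simp only: left right)
  also have "t \<^bold>* t' \<^bold>* (s \<^bold>* (t' \<^bold>* t)) = t \<^bold>* t' \<^bold>* (t \<^bold>* (t' \<^bold>* t))"
    using expand[of s] expand[of t] assms(3) by simp
  also have "\<dots> = (t \<^bold>* t' \<^bold>* t) \<^bold>* t' \<^bold>* t"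
    by (simp only: assoc)
  also have "\<dots> = t"
    by (simp only: t)
  finally show ?thesis .
qed

text \<open>
  The preimage of the congruence of \<open>G\<close> modulo the normal subgroup \<open>Z\<^sub>i\<close>.
\<close>

definition core_rel :: "nat \<Rightarrow> 'a rel" where
  "core_rel i = {(s, t). inv\<^bsub>G\<^esub> core s \<otimes>\<^bsub>G\<^esub> core t \<in> G.upper_central i}"

lemma core_rel_congruence: "congruence f (core_rel i)"
proof (rule congruenceI)
  show "(x, x) \<in> core_rel i" for x
    by (simp add: core_rel_def G.upper_central_one)
  show "(y, x) \<in> core_rel i" if "(x, y) \<in> core_rel i" for x y
  proof -
    have "inv\<^bsub>G\<^esub> (inv\<^bsub>G\<^esub> core x \<otimes>\<^bsub>G\<^esub> core y) \<in> G.upper_central i"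
      using that by (simp only: core_rel_def mem_Collect_eq prod.case G.upper_central_inv)
    then show ?thesis
      by (simp add: core_rel_def G.word_simps)
  qed
  show "(x, z) \<in> core_rel i" if "(x, y) \<in> core_rel i" "(y, z) \<in> core_rel i" for x y z
  proof -
    have "(inv\<^bsub>G\<^esub> core x \<otimes>\<^bsub>G\<^esub> core y) \<otimes>\<^bsub>G\<^esub> (inv\<^bsub>G\<^esub> core y \<otimes>\<^bsub>G\<^esub> core z)
        \<in> G.upper_central i"
      using that by (simp only: core_rel_def mem_Collect_eq prod.case G.upper_central_mult)
    then show ?thesis
      by (simp add: core_rel_def G.word_simps)
  qed
  show "(x \<^bold>* u, y \<^bold>* v) \<in> core_rel i"
    if "(x, y) \<in> core_rel i" "(u, v) \<in> core_rel i" for x y u v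
  proof -
    have "(inv\<^bsub>G\<^esub> core u \<otimes>\<^bsub>G\<^esub> (inv\<^bsub>G\<^esub> core x \<otimes>\<^bsub>G\<^esub> core y) \<otimes>\<^bsub>G\<^esub> core u)
        \<otimes>\<^bsub>G\<^esub> (inv\<^bsub>G\<^esub> core u \<otimes>\<^bsub>G\<^esub> core v) \<in> G.upper_central i"
      using that by (intro G.upper_central_mult[OF G.upper_central_conj]) (simp_all add: core_rel_def)
    then show ?thesis
      by (simp add: core_rel_def core_mult_G G.word_simps)
  qed
qed

lemma core_rel_0: "(s, t) \<in> core_rel 0 \<Longrightarrow> core s = core t"
  using G.inv_cancel_left(1)[of "core s" "core t"] by (simp add: core_rel_def)

text \<open>
  Replacing \<open>c\<close> by \<open>d\<close> multiplies the occurrences of these arguments by elements that are central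
  modulo \<open>Z\<^sub>i\<close>. These move to the end of the product, where they form the factor \<open>z\<close>. It is
  independent of the other arguments \<open>x\<close>; only the error term \<open>w \<in> Z\<^sub>i\<close> depends on them.
\<close>

lemma Pol_central_shift:
  assumes cd: "list_all2 (\<lambda>x y. (x, y) \<in> core_rel (Suc i)) c d"
    and "p \<in> Pol f (N + length c)"
  shows "\<exists>z \<in> G.upper_central (Suc i). \<forall>x. length x = N \<longrightarrow>
    (\<exists>w \<in> G.upper_central i. core (p (x @ d)) = core (p (x @ c)) \<otimes>\<^bsub>G\<^esub> (z \<otimes>\<^bsub>G\<^esub> w))"
  using assms(2)
proof (induction rule: Pol.induct)
  case (Pol_var j)
  let ?z = "if j < N then \<one>\<^bsub>G\<^esub> else inv\<^bsub>G\<^esub> core (c ! (j - N)) \<otimes>\<^bsub>G\<^esub> core (d ! (j - N))"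
  have "?z \<in> G.upper_central (Suc i)"
  proof (cases "j < N")
    case False
    then have "(c ! (j - N), d ! (j - N)) \<in> core_rel (Suc i)"
      using Pol_var by (intro list_all2_nthD[OF cd]) simp
    then show ?thesis
      using False by (simp add: core_rel_def)
  qed (simp add: G.upper_central_one del: G.upper_central.simps)
  moreover have "core ((x @ d) ! j) = core ((x @ c) ! j) \<otimes>\<^bsub>G\<^esub> (?z \<otimes>\<^bsub>G\<^esub> \<one>\<^bsub>G\<^esub>)" if "length x = N" for x
    using that by (simp add: nth_append G.word_simps)
  ultimately show ?case
    using G.upper_central_one[of i] by blast
next
  case (Pol_const a)
  have "core a = core a \<otimes>\<^bsub>G\<^esub> (\<one>\<^bsub>G\<^esub> \<otimes>\<^bsub>G\<^esub> \<one>\<^bsub>G\<^esub>)"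
    by simp
  then show ?case
    using G.upper_central_one[of i] G.upper_central_one[of "Suc i"] by blast
next
  case (Pol_mult p q)
  obtain z where z: "z \<in> G.upper_central (Suc i)"
    and p: "\<And>x. length x = N \<Longrightarrow> \<exists>w \<in> G.upper_central i.
      core (p (x @ d)) = core (p (x @ c)) \<otimes>\<^bsub>G\<^esub> (z \<otimes>\<^bsub>G\<^esub> w)"
    using Pol_mult.IH(1) by blast
  obtain z' where z': "z' \<in> G.upper_central (Suc i)"
    and q: "\<And>x. length x = N \<Longrightarrow> \<exists>w \<in> G.upper_central i.
      core (q (x @ d)) = core (q (x @ c)) \<otimes>\<^bsub>G\<^esub> (z' \<otimes>\<^bsub>G\<^esub> w)"
    using Pol_mult.IH(2) by blast
  have "\<exists>w \<in> G.upper_central i. core (p (x @ d) \<^bold>* q (x @ d)) =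
      core (p (x @ c) \<^bold>* q (x @ c)) \<otimes>\<^bsub>G\<^esub> ((z \<otimes>\<^bsub>G\<^esub> z') \<otimes>\<^bsub>G\<^esub> w)" if x: "length x = N" for x
  proof -
    obtain w where w: "w \<in> G.upper_central i"
      "core (p (x @ d)) = core (p (x @ c)) \<otimes>\<^bsub>G\<^esub> (z \<otimes>\<^bsub>G\<^esub> w)"
      using p[OF x] by blast
    obtain w' where w': "w' \<in> G.upper_central i"
      "core (q (x @ d)) = core (q (x @ c)) \<otimes>\<^bsub>G\<^esub> (z' \<otimes>\<^bsub>G\<^esub> w')"
      using q[OF x] by blast
    let ?Q = "core (q (x @ c))"
    \<comment> \<open>Moving \<open>z\<close> past \<open>?Q\<close> costs \<open>[z, ?Q] \<in> Z\<^sub>i\<close>, and the other factors in \<open>Z\<^sub>i\<close> become conjugates.\<close>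
    let ?w = "(inv\<^bsub>G\<^esub> z' \<otimes>\<^bsub>G\<^esub> (G.comm z ?Q \<otimes>\<^bsub>G\<^esub> (inv\<^bsub>G\<^esub> ?Q \<otimes>\<^bsub>G\<^esub> w \<otimes>\<^bsub>G\<^esub> ?Q)) \<otimes>\<^bsub>G\<^esub> z') \<otimes>\<^bsub>G\<^esub> w'"
    have carrier: "z \<in> carrier G" "z' \<in> carrier G" "w \<in> carrier G" "w' \<in> carrier G"
      using z z' w(1) w'(1) G.upper_central_subset by blast+
    have "G.comm z ?Q \<in> G.upper_central i"
      using z by simp
    then have "G.comm z ?Q \<otimes>\<^bsub>G\<^esub> (inv\<^bsub>G\<^esub> ?Q \<otimes>\<^bsub>G\<^esub> w \<otimes>\<^bsub>G\<^esub> ?Q) \<in> G.upper_central i"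
      by (intro G.upper_central_mult[OF _ G.upper_central_conj]) (simp_all add: w(1))
    then have "?w \<in> G.upper_central i"
      using carrier w' by (intro G.upper_central_mult[OF G.upper_central_conj])
    moreover have "core (p (x @ d) \<^bold>* q (x @ d)) =
        core (p (x @ c) \<^bold>* q (x @ c)) \<otimes>\<^bsub>G\<^esub> ((z \<otimes>\<^bsub>G\<^esub> z') \<otimes>\<^bsub>G\<^esub> ?w)"
      using carrier by (simp add: core_mult_G w(2) w'(2) G.comm_def G.word_simps)
    ultimately show ?thesis
      by blast
  qed
  then show ?case
    using G.upper_central_mult[OF z z'] by blast
qed

text \<open>
  Both the premise and the conclusion of the term condition say that the shift \<open>z\<close> lies in \<open>Z\<^sub>i\<close>.
\<close>

lemma core_rel_centralizes: "centralizes f [UNIV] (core_rel (Suc i)) (core_rel i)"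
  unfolding centralizes_single_iff
proof (intro allI impI)
  fix a b c d :: "'a list" and p
  assume len: "length a = length b"
    and cd: "list_all2 (\<lambda>x y. (x, y) \<in> core_rel (Suc i)) c d"
    and p: "p \<in> Pol f (length a + length c)"
    and pa: "(p (a @ c), p (a @ d)) \<in> core_rel i"
  obtain z where z: "z \<in> G.upper_central (Suc i)" and
    shift: "\<And>x. length x = length a \<Longrightarrow> \<exists>w \<in> G.upper_central i.
      core (p (x @ d)) = core (p (x @ c)) \<otimes>\<^bsub>G\<^esub> (z \<otimes>\<^bsub>G\<^esub> w)"
    using Pol_central_shift[OF cd p] by blast
  have z_carrier: "z \<in> carrier G"
    using z by simp
  have iff: "(p (x @ c), p (x @ d)) \<in> core_rel i \<longleftrightarrow> z \<in> G.upper_central i"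
    if x: "length x = length a" for x
  proof -
    obtain w where w: "w \<in> G.upper_central i"
      "core (p (x @ d)) = core (p (x @ c)) \<otimes>\<^bsub>G\<^esub> (z \<otimes>\<^bsub>G\<^esub> w)"
      using shift[OF x] by blast
    have w_carrier: "w \<in> carrier G"
      using w(1) G.upper_central_subset by blast
    have "inv\<^bsub>G\<^esub> core (p (x @ c)) \<otimes>\<^bsub>G\<^esub> core (p (x @ d)) = z \<otimes>\<^bsub>G\<^esub> w"
      using z_carrier w_carrier by (simp add: w(2) G.word_simps)
    moreover have "(z \<otimes>\<^bsub>G\<^esub> w) \<otimes>\<^bsub>G\<^esub> inv\<^bsub>G\<^esub> w = z"
      using z_carrier w_carrier by (simp add: G.word_simps)
    ultimately show ?thesis
      using w(1) G.upper_central_mult G.upper_central_inv unfolding core_rel_def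
      by (metis (no_types, lifting) case_prodD case_prodI mem_Collect_eq)
  qed
  show "(p (b @ c), p (b @ d)) \<in> core_rel i"
    using iff[of a] iff[of b] pa len by simp
qed

lemma Pol_face_words:
  assumes "list_all2 (\<lambda>x y. length x = length y) a b" "p \<in> Pol f (length (concat a))"
  shows "(\<lambda>J. core (p (concat (choice J a b)))) \<in> G.face_words (length a)"
  using assms(2)
proof (induction rule: Pol.induct)
  case (Pol_var i)
  then obtain j u v where j: "j < length a"
    and eq: "\<And>J. concat (choice J a b) ! i = (if j \<in> J then u else v)"
    using nth_concat_choice[OF assms(1)] by blast
  have "(\<lambda>J. if j \<in> J then core u else core v) \<in> G.face_words (length a)"
    using j by (intro G.face_words.face) auto
  then show ?case
    by (simp add: eq if_distrib)
next
  case (Pol_const c)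
  show ?case
    by (rule G.face_words.const) simp
next
  case (Pol_mult p q)
  then show ?case
    by (simp add: core_mult_G G.face_words.mult)
qed

lemma upper_central_centralizes:
  assumes "G.upper_central n = carrier G"
  shows "centralizes f (replicate n UNIV) UNIV (core_rel 0)"
  unfolding centralizes_UNIV_iff
proof (intro allI impI)
  fix a b :: "'a list list" and p :: "'a list \<Rightarrow> 'a"
  let ?p = "\<lambda>J. p (concat (choice J a b))"
  assume a: "length a = Suc n" and ab: "list_all2 (\<lambda>x y. length x = length y) a b"
    and p: "p \<in> Pol f (length (concat a))"
    and J: "\<forall>J. J \<subset> {..<n} \<longrightarrow> (?p J, ?p (insert n J)) \<in> core_rel 0"
  have "core (?p {..<n}) = core (?p (insert n {..<n}))"
  proof (rule G.face_words_term_condition[OF assms, where x = "\<lambda>J. core (?p J)"])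
    show "(\<lambda>J. core (?p J)) \<in> G.face_words (Suc n)"
      using Pol_face_words[OF ab p] a by simp
    show "core (?p J) = core (?p (insert n J))" if "J \<subset> {..<n}" for J
      using J that by (intro core_rel_0) blast
  qed
  then show "(?p {..<n}, ?p (insert n {..<n})) \<in> core_rel 0"
    by (simp add: core_rel_def)
qed

lemma congruence_eq_IdI:
  assumes "congruence f \<delta>" "\<delta> \<subseteq> left_rel \<inter> right_rel" "\<delta> \<subseteq> core_rel 0"
  shows "\<delta> = Id"
  using assms(2,3) left_right_core_eq core_rel_0 congruence_refl[OF assms(1)] by fast

lemma upper_central_imp_supernilpotent:
  assumes "G.upper_central n = carrier G" "n \<ge> 1"
  shows "supernilpotent f n"
  unfolding supernilpotent_def
proof (rule congruence_eq_IdI)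
  have "replicate (n + 1) (UNIV :: 'a rel) = replicate n UNIV @ [UNIV]"
    by (simp add: replicate_append_same)
  then show "commutator f (replicate (n + 1) UNIV) \<subseteq> core_rel 0"
    using upper_central_centralizes[OF assms(1)]
    by (intro commutator_minimal core_rel_congruence) (simp del: replicate_Suc)
  show "commutator f (replicate (n + 1) UNIV) \<subseteq> left_rel \<inter> right_rel"
    using assms(2) by (intro commutator_left_right) simp
qed (rule commutator_congruence)

lemma upper_central_imp_nilpotent:
  assumes "G.upper_central n = carrier G" "n \<ge> 1"
  shows "nilpotent f n"
  unfolding nilpotent_def
proof (rule congruence_eq_IdI)
  have "central_series f k \<subseteq> core_rel (n - k)" if "k \<le> n" for k
    using that
  proof (induction k)
    case 0
    then show ?case
      using assms(1) by (simp add: core_rel_def)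
  next
    case (Suc k)
    then have "central_series f k \<subseteq> core_rel (Suc (n - Suc k))"
      by (simp add: Suc_diff_Suc)
    then have "centralizes f [UNIV] (central_series f k) (core_rel (n - Suc k))"
      by (intro centralizes_mono[OF core_rel_centralizes]) simp_all
    then show ?case
      using commutator_minimal[OF core_rel_congruence, of "[UNIV, central_series f k]"] by simp
  qed
  from this[of n] show "central_series f n \<subseteq> core_rel 0"
    by simp
  obtain k where "n = Suc k"
    using assms(2) by (cases n) auto
  then show "central_series f n \<subseteq> left_rel \<inter> right_rel"
    using commutator_left_right[of "[UNIV, central_series f k]"] by simp
qed (rule central_series_congruence)

text \<open>
  The term condition for the word \<open>y' x' y x\<close> at the blocks \<open>(h, h\<^sup>-\<^sup>1)\<close> and \<open>(g, g\<^sup>-\<^sup>1)\<close> shows that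
  if \<open>g\<close> is related to \<open>1\<close> by a term of the central series, then \<open>[g, h]\<close> is related to \<open>1\<close> by the
  next one. So the central series descends at least as slowly as the lower central series of \<open>G\<close>.
\<close>

lemma nilpotent_imp_upper_central:
  assumes "nilpotent f n"
  shows "G.upper_central n = carrier G"
proof -
  have "g \<in> G.upper_central i"
    if "i \<le> n" "g \<in> carrier G" "(g, \<one>\<^bsub>G\<^esub>) \<in> central_series f (n - i)" for i g
    using that
  proof (induction i arbitrary: g)
    case 0
    then show ?case
      using assms by (simp add: nilpotent_def)
  next
    case (Suc i)
    define \<beta> where "\<beta> = central_series f (n - Suc i)"
    define \<delta> where "\<delta> = central_series f (n - i)"
    have \<beta>: "congruence f \<beta>" and \<delta>: "congruence f \<delta>"
      by (simp_all add: \<beta>_def \<delta>_def central_series_congruence)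
    have "\<delta> = central_series f (Suc (n - Suc i))"
      unfolding \<delta>_def using Suc.prems(1) by (simp add: Suc_diff_Suc)
    then have C: "centralizes f [UNIV] \<beta> \<delta>"
      by (simp add: \<beta>_def central_series_centralizes del: central_series.simps)
    have g: "(g, \<one>\<^bsub>G\<^esub>) \<in> \<beta>"
      using Suc.prems(3) by (simp add: \<beta>_def)
    have "(inv\<^bsub>G\<^esub> g \<otimes>\<^bsub>G\<^esub> g, inv\<^bsub>G\<^esub> g \<otimes>\<^bsub>G\<^esub> \<one>\<^bsub>G\<^esub>) \<in> \<beta>"
      unfolding mult_G by (rule congruence_mult[OF \<beta> congruence_refl[OF \<beta>] g])
    then have g': "(inv\<^bsub>G\<^esub> g, \<one>\<^bsub>G\<^esub>) \<in> \<beta>"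
      using Suc.prems(2) congruence_sym[OF \<beta>] by simp
    have "G.comm g h \<in> G.upper_central i" if h: "h \<in> carrier G" for h
    proof (rule Suc.IH)
      let ?a = "[\<one>\<^bsub>G\<^esub>, \<one>\<^bsub>G\<^esub>]" and ?b = "[h, inv\<^bsub>G\<^esub> h]" and ?c = "[g, inv\<^bsub>G\<^esub> g]"
      define p where "p x = (x ! 3 \<otimes>\<^bsub>G\<^esub> x ! 1) \<otimes>\<^bsub>G\<^esub> (x ! 2 \<otimes>\<^bsub>G\<^esub> x ! 0)" for x
      have p: "p \<in> Pol f (length ?a + length ?c)"
        unfolding p_def mult_G by (intro Pol_mult Pol_var) auto
      have "p (?a @ ?c) = \<one>\<^bsub>G\<^esub>" "p (?a @ ?a) = \<one>\<^bsub>G\<^esub>" "p (?b @ ?a) = \<one>\<^bsub>G\<^esub>"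
          "p (?b @ ?c) = G.comm g h"
        using Suc.prems(2) h
        by (simp_all add: p_def numeral_eq_Suc G.comm_def G.word_simps)
      moreover have "(p (?b @ ?c), p (?b @ ?a)) \<in> \<delta>" if "(p (?a @ ?c), p (?a @ ?a)) \<in> \<delta>"
        by (rule C[unfolded centralizes_single_iff, rule_format, OF _ _ _ _ p that])
          (use g g' in simp_all)
      ultimately show "(G.comm g h, \<one>\<^bsub>G\<^esub>) \<in> central_series f (n - i)"
        using congruence_refl[OF \<delta>] by (simp flip: \<delta>_def)
    qed (use Suc.prems h in auto)
    then show ?case
      using Suc.prems(2) by simp
  qed
  from this[of n] have "carrier G \<subseteq> G.upper_central n"
    by auto
  then show ?thesis
    using G.upper_central_subset by blast
qed

text \<open>
  A left-normed commutator together with its inverse, as a pair of words. The arguments come in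
  pairs: entries \<open>2 j\<close> and \<open>2 j + 1\<close> are meant to be \<open>h j\<close> and its inverse.
\<close>

primrec comm_word :: "nat \<Rightarrow> 'a list \<Rightarrow> 'a \<times> 'a" where
  "comm_word 0 x = (x ! 0, x ! 1)"
| "comm_word (Suc j) x =
    ((snd (comm_word j x) \<otimes>\<^bsub>G\<^esub> x ! (2 * j + 3)) \<otimes>\<^bsub>G\<^esub> (fst (comm_word j x) \<otimes>\<^bsub>G\<^esub> x ! (2 * j + 2)),
     (x ! (2 * j + 3) \<otimes>\<^bsub>G\<^esub> snd (comm_word j x)) \<otimes>\<^bsub>G\<^esub> (x ! (2 * j + 2) \<otimes>\<^bsub>G\<^esub> fst (comm_word j x)))"

lemma comm_word_Pol:
  "2 * j + 1 < N \<Longrightarrow>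
    (\<lambda>x. fst (comm_word j x)) \<in> Pol f N \<and> (\<lambda>x. snd (comm_word j x)) \<in> Pol f N"
proof (induction j)
  case 0
  then show ?case
    by (auto intro: Pol_var)
next
  case (Suc j)
  then show ?case
    by (simp add: mult_G del: One_nat_def) (intro conjI Pol_mult Pol_var; simp)
qed

definition blocks :: "(nat \<Rightarrow> 'a) \<Rightarrow> nat \<Rightarrow> 'a list list" where
  "blocks h m = map (\<lambda>j. [h j, inv\<^bsub>G\<^esub> h j]) [0..<m]"

lemma length_concat_blocks: "length (concat (blocks h m)) = 2 * m"
  by (simp add: blocks_def length_concat comp_def sum_list_triv)

lemma nth_concat_blocks:
  "j < m \<Longrightarrow> concat (blocks h m) ! (2 * j) = h j \<and> concat (blocks h m) ! (2 * j + 1) = inv\<^bsub>G\<^esub> h j"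
proof (induction m)
  case (Suc m)
  have "concat (blocks h (Suc m)) = concat (blocks h m) @ [h m, inv\<^bsub>G\<^esub> h m]"
    by (simp add: blocks_def)
  then show ?case
    using Suc by (cases "j = m") (auto simp: nth_append length_concat_blocks)
qed simp

lemma comm_word_blocks:
  assumes "range h \<subseteq> carrier G" "j < m"
  shows "comm_word j (concat (blocks h m)) = (G.iterated_comm h j, inv\<^bsub>G\<^esub> G.iterated_comm h j)"
  using assms(2)
proof (induction j)
  case 0
  then show ?case
    using nth_concat_blocks[of 0 m h] by simp
next
  case (Suc j)
  have "concat (blocks h m) ! (2 * j + 2) = h (Suc j)"
    "concat (blocks h m) ! (2 * j + 3) = inv\<^bsub>G\<^esub> h (Suc j)"
    using nth_concat_blocks[OF Suc.prems, of h] by (simp_all add: numeral_eq_Suc)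
  moreover have "h (Suc j) \<in> carrier G" "G.iterated_comm h j \<in> carrier G"
    using assms(1) G.iterated_comm_closed[OF assms(1)] by auto
  ultimately show ?case
    using Suc by (simp add: G.comm_def G.word_simps)
qed

lemma choice_blocks:
  "choice J (blocks u m) (blocks v m) = blocks (\<lambda>j. if j \<in> J then v j else u j) m"
  by (simp add: choice_def blocks_def)

text \<open>
  A left-normed commutator of \<open>n + 1\<close> elements vanishes when one of them is \<open>1\<close>. The term condition
  for its word compares a value with an entry \<open>1\<close> in the last block with the value at \<open>h\<close>, so the
  commutator always vanishes.
\<close>

lemma supernilpotent_imp_upper_central:
  assumes "supernilpotent f n"
  shows "G.upper_central n = carrier G"
proof -
  have "G.iterated_comm h n = \<one>\<^bsub>G\<^esub>" if h: "range h \<subseteq> carrier G" for h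
  proof -
    let ?p = "\<lambda>x. fst (comm_word n x)"
    let ?x = "\<lambda>J. concat (choice J (blocks (\<lambda>j. \<one>\<^bsub>G\<^esub>) (Suc n)) (blocks h (Suc n)))"
    let ?h = "\<lambda>J j. if j \<in> J then h j else \<one>\<^bsub>G\<^esub>"
    have hJ: "range (?h J) \<subseteq> carrier G" for J
      using h by auto
    have p: "?p (?x J) = G.iterated_comm (?h J) n" for J
      by (simp add: choice_blocks comm_word_blocks[OF hJ])
    have trivial: "?p (?x J) = \<one>\<^bsub>G\<^esub>" if "i \<le> n" "i \<notin> J" for i J
      using G.iterated_comm_trivial[OF hJ that(1)] that(2) p by simp
    have "(?p (?x {..<n}), ?p (?x (insert n {..<n}))) \<in> Id"
    proof (rule supernilpotent_centralizes[OF assms, unfolded centralizes_UNIV_iff, rule_format])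
      show "?p \<in> Pol f (length (concat (blocks (\<lambda>j. \<one>\<^bsub>G\<^esub>) (Suc n))))"
        using comm_word_Pol[of n "2 * Suc n"] by (simp only: length_concat_blocks) simp
      show "(?p (?x J), ?p (?x (insert n J))) \<in> Id" if "J \<subset> {..<n}" for J
      proof -
        obtain i where "i < n" "i \<notin> J"
          using \<open>J \<subset> {..<n}\<close> by blast
        then show ?thesis
          using trivial[of i J] trivial[of i "insert n J"] by simp
      qed
    qed (auto simp: blocks_def list_all2_conv_all_nth simp del: upt_Suc)
    moreover have "?p (?x {..<n}) = \<one>\<^bsub>G\<^esub>"
      by (rule trivial[of n]) simp_all
    moreover have "G.iterated_comm (?h (insert n {..<n})) n = G.iterated_comm h n"
      by (rule G.iterated_comm_cong) auto
    ultimately show ?thesis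
      using p[of "insert n {..<n}"] by simp
  qed
  then have "g \<in> G.upper_central n" if "g \<in> carrier G" for g
    using G.iterated_comm_upper_central[of 0 n "\<lambda>_. g"] that by simp
  then show ?thesis
    using G.upper_central_subset by blast
qed

end

theorem corollary4p8:
  fixes f :: "'a \<Rightarrow> 'a \<Rightarrow> 'a" and n :: nat
  assumes "orthodox_semigroup f" and "n \<ge> 1"
  shows "supernilpotent f n \<longleftrightarrow> nilpotent f n"
proof -
  interpret orthodox_semigroup f
    by (rule assms(1))
  have iff: "supernilpotent f n \<longleftrightarrow> nilpotent f n" if "rectangular_group f e" for e
  proof -
    interpret rectangular_group f e
      by (rule that)
    show ?thesis
      using supernilpotent_imp_upper_central upper_central_imp_supernilpotent
        nilpotent_imp_upper_central upper_central_imp_nilpotent assms(2) by blast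
  qed
  have "\<exists>e. rectangular_group f e" if "supernilpotent f n \<or> nilpotent f n"
  proof (rule rectangular_groupI)
    fix g k
    assume "f g g = g" "f g k = k" "f k g = k" "f k k = k"
    then show "k = g"
      using that assms(2) nilpotent_below_idempotent[of f n g k]
        supernilpotent_below_idempotent[of f n g k] by blast
  qed
  then show ?thesis
    using iff by blast
qed

end
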